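(* Let $(J_n,X_n)_{n\ge 0}$ be a Markov renewal process with finite state space $\mathbb{X}=\{0,\dots,m\}$ and transition probabilities $Q_{ij}(t)$, let $J(t)$ be the associated semi-Markov process, let $d\ge1$ be an integer, and assume that conditions $\mathbf{A}$, $\mathbf{B}$, $\mathbf{C}_d$ (stated in the context) hold. Let $i\in\{1,\dots,m\}$ and let $\langle k_1,\dots,k_m\rangle$ be any permutation of $\langle1,\dots,m\rangle$ with $k_m=i$. For $n=0,\dots,m$ let $\mathbb{X}_n=\mathbb{X}\setminus\{k_1,\dots,k_n\}$, and let ${}_np_{i'j'}$, ${}_ne^{(r)}_{i'j'}$ be the transition probabilities and moments of transition times of the semi-Markov process obtained from $J(t)$ by sequentially excluding the states $k_1,\dots,k_n$ (defined in the context), so that ${}_0p_{i'j'}=p_{i'j'}$, ${}_0e^{(r)}_{i'j'}=e^{(r)}_{i'j'}$ and ${}_ne^{(0)}_{i'j'}={}_np_{i'j'}$. Then: 1. For $n=1,\dots,m$, these quantities are determined by the following recurrent formulas, for $i',j'\in\mathbb{X}_n$ and (used recurrently) $r=1,\dots,d$: $$ {}_np_{k_nj'}=\frac{{}_{n-1}p_{k_nj'}}{1-{}_{n-1}p_{k_nk_n}},\qquad {}_np_{i'j'}={}_{n-1}p_{i'j'}+{}_{n-1}p_{i'k_n}\frac{{}_{n-1}p_{k_nj'}}{1-{}_{n-1}p_{k_nk_n}},$$ $$ {}_ne^{(r)}_{k_nj'}=\frac{1}{1-{}_{n-1}p_{k_nk_n}}\Big({}_{n-1}e^{(r)}_{k_nj'}+\sum_{l=0}^{r-1}\binom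 rl\,{}_{n-1}e^{(r-l)}_{k_nk_n}\;{}_ne^{(l)}_{k_nj'}\Big),$$ $$ {}_ne^{(r)}_{i'j'}={}_{n-1}e^{(r)}_{i'j'}+\sum_{l=0}^{r-1}\binom rl\,{}_{n-1}e^{(r-l)}_{i'k_n}\;{}_ne^{(l)}_{k_nj'}+\frac{{}_{n-1}p_{i'k_n}}{1-{}_{n-1}p_{k_nk_n}}\Big({}_{n-1}e^{(r)}_{k_nj'}+\sum_{l=0}^{r-1}\binom rl\,{}_{n-1}e^{(r-l)}_{k_nk_n}\;{}_ne^{(l)}_{k_nj'}\Big),$$ and, for $n=m$, ${}_mp_{i0}={}_mp_{00}=1$. 2. The moments of the hitting time to state $0$ are given by $$E^{(r)}_{i0}={}_me^{(r)}_{i0},\qquad E^{(r)}_{00}={}_me^{(r)}_{00},\qquad r=1,\dots,d.$$ 3. The moments $E^{(r)}_{i0}$, $E^{(r)}_{00}$, $r=1,\dots,d$, so computed are invariant with respect to the choice of the permutation $\langle k_1,\dots,k_m\rangle$ of $\langle1,\dots,m\rangle$ (with $k_m=i$) used in the recurrent algorithm.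
   Context: **Markov renewal process.** $(J_n,X_n)$, $n=0,1,\dots$, is a homogeneous Markov chain with phase space $\mathbb{X}\times[0,\infty)$, $\mathbb{X}=\{0,\dots,m\}$, with $X_0=0$ and transition probabilities, not depending on $s$, $$Q_{ij}(t)=\mathsf{P}\{J_1=j,\,X_1\le t\mid J_0=i,\,X_0=s\},\qquad (i,s),(j,t)\in\mathbb{X}\times[0,\infty).$$ The sequence $J_n$ is then a homogeneous Markov chain (the embedded chain) with transition probabilities $p_{ij}=Q_{ij}(\infty)$. Let $T_n=X_1+\dots+X_n$, $T_0=0$, $N(t)=\max\{n\ge0:T_n\le t\}$. The semi-Markov process is $J(t)=J_{N(t)}$, $t\ge0$. $\mathsf{P}_{i'}$ and $\mathsf{E}_{i'}$ denote probability and expectation for the process started from $J_0=i'$, $X_0=0$. **Moments.** $e^{(r)}_{i'j'}=\mathsf{E}_{i'}[X_1^rI(J_1=j')]=\int_0^\infty t^r\,Q_{i'j'}(dt)$, $r=0,1,\dots$, with $e^{(0)}_{i'j'}=p_{i'j'}$. **Conditions.** - $\mathbf{A}$: $\mathbb{X}$ is a communicative class of states for the embedded Markov chain $J_n$ (every state can be reached from every state with positive probability). - $\mathbf{B}$: $Q_{ij}(0)=0$ for all $i,j\in\mathbb{X}$. - $\mathbf{C}_d$: $e^{(d)}_{ij}<\infty$ for all $i,j\in\mathbb{X}$. **Hitting time.** $U_0=\min\{n\ge1:J_n=0\}$, $W_0=\inf\{t\ge X_1:J(t)=0\}=\sum_{n=1}^{U_0}X_n$, and $E^{(r)}_{i'0}=\mathsf{E}_{i'}W_0^r$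 for $i'\in\mathbb{X}$. **Exclusion of one state.** Given a Markov renewal process $(J_n,X_n)$ whose embedded chain has phase space $\mathbb{Y}$, and $k\in\mathbb{Y}$, the process reduced by excluding $k$ is defined as follows. Let $V_0=0$, $V_n=\min\{r>V_{n-1}:J_r\in\mathbb{Y}\setminus\{k\}\}$ for $n\ge1$. The reduced Markov renewal process has value $(J_0,0)$ at time $0$ and value $\big(J_{V_n},\sum_{r=V_{n-1}+1}^{V_n}X_r\big)$ at time $n\ge1$. Its transitions lead into the reduced phase space $\mathbb{Y}\setminus\{k\}$; it may be started from any state of $\mathbb{Y}$, including $k$. **Sequential reduction.** For a permutation $\langle k_1,\dots,k_m\rangle$ of $\langle1,\dots,m\rangle$ with $k_m=i$, put $({}_0J_l,{}_0X_l)=(J_l,X_l)$, and for $n=1,\dots,m$ let $({}_nJ_l,{}_nX_l)_{l\ge0}$ be the Markov renewal process obtained from $({}_{n-1}J_l,{}_{n-1}X_l)_{l\ge0}$ (with phase space $\mathbb{X}_{n-1}=\mathbb{X}\setminus\{k_1,\dots,k_{n-1}\}$) by excluding the state $k_n$. Its reduced phase space is $\mathbb{X}_n=\mathbb{X}_{n-1}\setminus\{k_n\}$. For $i'\in\mathbb{X}_{n-1}=\mathbb{X}_n\cup\{k_n\}$ and $j'\in\mathbb{X}_n$ (for $n=0$: $i',j'\in\mathbb{X}$), put $${}_np_{i'j'}=\mathsf{P}_{i'}\{{}_nJ_1=j'\},\qquad {}_ne^{(r)}_{i'j'}=\mathsf{E}_{i'}\big[({}_nX_1)^rI({}_nJ_1=j')\big],\quad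 r=0,1,\dots,d.$$ In particular $\mathbb{X}_m=\{0\}$. *)

theory Defs
  imports "HOL-Probability.Probability"
begin

text \<open>
  A Markov renewal process \<open>(J n, X n)\<close> with phase space \<open>{0..m} \<times> [0,\<infinity>)\<close> on a measurable space \<open>\<Omega>\<close>.
  \<open>P i\<close> is the probability measure under which the process starts from \<open>J 0 = i\<close>, \<open>X 0 = 0\<close>, and
  \<open>Q i j t\<close> is the transition probability, meaningful for \<open>i, j \<le> m\<close> and \<open>t \<ge> 0\<close>.  The last
  assumption is the homogeneous Markov property with respect to the natural filtration of the pair;
  the right-hand side depends on \<open>J n\<close> only, not on the value of \<open>X n\<close>.
\<close>

definition history :: "nat \<Rightarrow> 'a measure \<Rightarrow> (nat \<Rightarrow> 'a \<Rightarrow> nat) \<Rightarrow> (nat \<Rightarrow> 'a \<Rightarrow> real) \<Rightarrow> nat \<Rightarrow> 'a measure" where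
  "history m \<Omega> J X n =
     vimage_algebra (space \<Omega>) (\<lambda>\<omega>. \<lambda>l\<in>{..n}. (J l \<omega>, X l \<omega>))
       (\<Pi>\<^sub>M l\<in>{..n}. count_space {0..m} \<Otimes>\<^sub>M (borel :: real measure))"

locale markov_renewal_process =
  fixes m :: nat
    and Q :: "nat \<Rightarrow> nat \<Rightarrow> real \<Rightarrow> real"
    and \<Omega> :: "'a measure"
    and P :: "nat \<Rightarrow> 'a measure"
    and J :: "nat \<Rightarrow> 'a \<Rightarrow> nat"
    and X :: "nat \<Rightarrow> 'a \<Rightarrow> real"
  assumes prob_space_P: "\<And>i. i \<le> m \<Longrightarrow> prob_space (P i)"
    and sets_P: "\<And>i. i \<le> m \<Longrightarrow> sets (P i) = sets \<Omega>"
    and measurable_J: "\<And>n. J n \<in> \<Omega> \<rightarrow>\<^sub>M count_space {0..m}"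
    and measurable_X: "\<And>n. X n \<in> borel_measurable \<Omega>"
    and X_nonneg: "\<And>n \<omega>. \<omega> \<in> space \<Omega> \<Longrightarrow> 0 \<le> X n \<omega>"
    and initial: "\<And>i. i \<le> m \<Longrightarrow> AE \<omega> in P i. J 0 \<omega> = i \<and> X 0 \<omega> = 0"
    and markov: "\<And>i n j t. i \<le> m \<Longrightarrow> j \<le> m \<Longrightarrow> 0 \<le> t \<Longrightarrow>
      AE \<omega> in P i.
        real_cond_exp (P i) (history m \<Omega> J X n)
          (indicator {\<omega> \<in> space \<Omega>. J (Suc n) \<omega> = j \<and> X (Suc n) \<omega> \<le> t}) \<omega>
        = Q (J n \<omega>) j t"

text \<open>The transition probability \<open>Q i j \<infinity>\<close> of the embedded chain.\<close>

definition embedded_prob :: "(nat \<Rightarrow> nat \<Rightarrow> real \<Rightarrow> real) \<Rightarrow> nat \<Rightarrow> nat \<Rightarrow> real" where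
  "embedded_prob Q i j = Lim at_top (Q i j)"

text \<open>Moments take values in \<open>[0,\<infinity>]\<close>, so that they exist without any integrability assumption.\<close>

definition transition_moment ::
    "(nat \<Rightarrow> 'a measure) \<Rightarrow> (nat \<Rightarrow> 'a \<Rightarrow> nat) \<Rightarrow> (nat \<Rightarrow> 'a \<Rightarrow> real) \<Rightarrow> nat \<Rightarrow> nat \<Rightarrow> nat \<Rightarrow> ennreal" where
  "transition_moment P J X r i j =
     (\<integral>\<^sup>+ \<omega>. ennreal (X 1 \<omega> ^ r) * indicator {\<omega>. J 1 \<omega> = j} \<omega> \<partial>P i)"

definition communicating :: "nat \<Rightarrow> (nat \<Rightarrow> 'a measure) \<Rightarrow> (nat \<Rightarrow> 'a \<Rightarrow> nat) \<Rightarrow> bool" where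
  "communicating m P J \<longleftrightarrow>
     (\<forall>i\<in>{0..m}. \<forall>j\<in>{0..m}. \<exists>n\<ge>1. 0 < measure (P i) {\<omega> \<in> space (P i). J n \<omega> = j})"

text \<open>
  The semi-Markov process and the hitting time of state 0, defined for a single trajectory
  \<open>(j n, x n)\<close>.  If infinitely many jump times are \<open>\<le> t\<close>, the value of \<open>Max\<close> is unspecified; this
  event is null for the processes considered.  A trajectory that does not hit 0 has hitting time
  \<open>\<infinity>\<close>.
\<close>

definition jump_time :: "(nat \<Rightarrow> real) \<Rightarrow> nat \<Rightarrow> real" where
  "jump_time x n = (\<Sum>l=1..n. x l)"

definition jump_count :: "(nat \<Rightarrow> real) \<Rightarrow> real \<Rightarrow> nat" where
  "jump_count x t = Max {n. jump_time x n \<le> t}"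

definition semi_markov :: "(nat \<Rightarrow> nat) \<Rightarrow> (nat \<Rightarrow> real) \<Rightarrow> real \<Rightarrow> nat" where
  "semi_markov j x t = j (jump_count x t)"

definition hitting_time :: "(nat \<Rightarrow> nat) \<Rightarrow> (nat \<Rightarrow> real) \<Rightarrow> ennreal" where
  "hitting_time j x = (INF t\<in>{t. x 1 \<le> t \<and> semi_markov j x t = 0}. ennreal t)"

definition hitting_moment ::
    "(nat \<Rightarrow> 'a measure) \<Rightarrow> (nat \<Rightarrow> 'a \<Rightarrow> nat) \<Rightarrow> (nat \<Rightarrow> 'a \<Rightarrow> real) \<Rightarrow> nat \<Rightarrow> nat \<Rightarrow> ennreal" where
  "hitting_moment P J X r i = (\<integral>\<^sup>+ \<omega>. hitting_time (\<lambda>n. J n \<omega>) (\<lambda>n. X n \<omega>) ^ r \<partial>P i)"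

text \<open>
  Exclusion of states, for a single trajectory \<open>z n = (j n, x n)\<close>.  \<open>visit S j n\<close> is the time of the
  \<open>n\<close>-th visit of \<open>j\<close> to \<open>S\<close> after time 0; \<open>LEAST\<close> is unspecified when there is no such visit, which
  is again a null event for the processes considered.
\<close>

primrec visit :: "nat set \<Rightarrow> (nat \<Rightarrow> nat) \<Rightarrow> nat \<Rightarrow> nat" where
  "visit S j 0 = 0"
| "visit S j (Suc n) = (LEAST r. visit S j n < r \<and> j r \<in> S)"

definition exclude :: "nat set \<Rightarrow> nat \<Rightarrow> (nat \<Rightarrow> nat \<times> real) \<Rightarrow> nat \<Rightarrow> nat \<times> real" where
  "exclude Y k z n =
     (let V = visit (Y - {k}) (\<lambda>l. fst (z l)) in
      if n = 0 then (fst (z 0), 0)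
      else (fst (z (V n)), \<Sum>r\<in>{V (n - 1)<..V n}. snd (z r)))"

definition phase_space :: "nat \<Rightarrow> (nat \<Rightarrow> nat) \<Rightarrow> nat \<Rightarrow> nat set" where
  "phase_space m k n = {0..m} - k ` {1..n}"

primrec reduced :: "nat \<Rightarrow> (nat \<Rightarrow> nat) \<Rightarrow> nat \<Rightarrow> (nat \<Rightarrow> nat \<times> real) \<Rightarrow> nat \<Rightarrow> nat \<times> real" where
  "reduced m k 0 z = z"
| "reduced m k (Suc n) z = exclude (phase_space m k n) (k (Suc n)) (reduced m k n z)"

definition reduced_J ::
    "nat \<Rightarrow> (nat \<Rightarrow> nat) \<Rightarrow> (nat \<Rightarrow> 'a \<Rightarrow> nat) \<Rightarrow> (nat \<Rightarrow> 'a \<Rightarrow> real) \<Rightarrow> nat \<Rightarrow> nat \<Rightarrow> 'a \<Rightarrow> nat" where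
  "reduced_J m k J X n l \<omega> = fst (reduced m k n (\<lambda>l. (J l \<omega>, X l \<omega>)) l)"

definition reduced_X ::
    "nat \<Rightarrow> (nat \<Rightarrow> nat) \<Rightarrow> (nat \<Rightarrow> 'a \<Rightarrow> nat) \<Rightarrow> (nat \<Rightarrow> 'a \<Rightarrow> real) \<Rightarrow> nat \<Rightarrow> nat \<Rightarrow> 'a \<Rightarrow> real" where
  "reduced_X m k J X n l \<omega> = snd (reduced m k n (\<lambda>l. (J l \<omega>, X l \<omega>)) l)"

definition reduced_prob ::
    "nat \<Rightarrow> (nat \<Rightarrow> nat) \<Rightarrow> (nat \<Rightarrow> 'a measure) \<Rightarrow> (nat \<Rightarrow> 'a \<Rightarrow> nat) \<Rightarrow> (nat \<Rightarrow> 'a \<Rightarrow> real) \<Rightarrow>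
      nat \<Rightarrow> nat \<Rightarrow> nat \<Rightarrow> ennreal" where
  "reduced_prob m k P J X n i j = emeasure (P i) {\<omega> \<in> space (P i). reduced_J m k J X n 1 \<omega> = j}"

definition reduced_moment ::
    "nat \<Rightarrow> (nat \<Rightarrow> nat) \<Rightarrow> (nat \<Rightarrow> 'a measure) \<Rightarrow> (nat \<Rightarrow> 'a \<Rightarrow> nat) \<Rightarrow> (nat \<Rightarrow> 'a \<Rightarrow> real) \<Rightarrow>
      nat \<Rightarrow> nat \<Rightarrow> nat \<Rightarrow> nat \<Rightarrow> ennreal" where
  "reduced_moment m k P J X n = transition_moment P (reduced_J m k J X n) (reduced_X m k J X n)"

text \<open>
  The recurrent algorithm for arrays \<open>p n i j\<close> and \<open>e n r i j\<close> with initial data \<open>p0 i j\<close> and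
  \<open>e0 r i j\<close>.  The level-\<open>n\<close> quantities are indexed by a starting state in \<open>phase_space m k (n - 1)\<close>
  and a target state in \<open>phase_space m k n\<close>; for \<open>n = 0\<close> both are \<open>{0..m}\<close>.
\<close>

definition recurrent_algorithm ::
    "nat \<Rightarrow> nat \<Rightarrow> (nat \<Rightarrow> nat) \<Rightarrow> (nat \<Rightarrow> nat \<Rightarrow> ennreal) \<Rightarrow> (nat \<Rightarrow> nat \<Rightarrow> nat \<Rightarrow> ennreal) \<Rightarrow>
      (nat \<Rightarrow> nat \<Rightarrow> nat \<Rightarrow> ennreal) \<Rightarrow> (nat \<Rightarrow> nat \<Rightarrow> nat \<Rightarrow> nat \<Rightarrow> ennreal) \<Rightarrow> bool" where
  "recurrent_algorithm m d k p0 e0 p e \<longleftrightarrow>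
     (\<forall>i\<in>{0..m}. \<forall>j\<in>{0..m}. p 0 i j = p0 i j \<and> (\<forall>r\<in>{1..d}. e 0 r i j = e0 r i j)) \<and>
     (\<forall>n\<in>{0..m}. \<forall>i\<in>phase_space m k (n - 1). \<forall>j\<in>phase_space m k n. e n 0 i j = p n i j) \<and>
     (\<forall>n\<in>{1..m}. \<forall>j\<in>phase_space m k n.
        p n (k n) j = p (n - 1) (k n) j / (1 - p (n - 1) (k n) (k n)) \<and>
        (\<forall>i\<in>phase_space m k n.
           p n i j = p (n - 1) i j
             + p (n - 1) i (k n) * (p (n - 1) (k n) j / (1 - p (n - 1) (k n) (k n)))) \<and>
        (\<forall>r\<in>{1..d}.
           e n r (k n) j =
             1 / (1 - p (n - 1) (k n) (k n)) *
               (e (n - 1) r (k n) j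
                + (\<Sum>l=0..r-1. of_nat (r choose l) * e (n - 1) (r - l) (k n) (k n) * e n l (k n) j)) \<and>
           (\<forall>i\<in>phase_space m k n.
              e n r i j =
                e (n - 1) r i j
                + (\<Sum>l=0..r-1. of_nat (r choose l) * e (n - 1) (r - l) i (k n) * e n l (k n) j)
                + p (n - 1) i (k n) / (1 - p (n - 1) (k n) (k n)) *
                    (e (n - 1) r (k n) j
                     + (\<Sum>l=0..r-1. of_nat (r choose l) * e (n - 1) (r - l) (k n) (k n) * e n l (k n) j)))))"

definition exclusion_order :: "nat \<Rightarrow> nat \<Rightarrow> (nat \<Rightarrow> nat) \<Rightarrow> bool" where
  "exclusion_order m i k \<longleftrightarrow> bij_betw k {1..m} {1..m} \<and> k m = i"

end

theory Submission
  imports Defs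
begin

text \<open>
  Excluding \<open>k\<^sub>1, \<dots>, k\<^sub>n\<close> one after the other amounts to watching the original process only at
  its visits to \<open>S = {0..m} - {k\<^sub>1, \<dots>, k\<^sub>n}\<close>, so the moments at level \<open>n\<close> are those of the first
  passage to \<open>S\<close>.  A passage to \<open>S - {k}\<close> either ends at the first visit to \<open>S\<close>, or that visit is
  to \<open>k\<close> and the passage continues with an independent passage started from \<open>k\<close>.  The
  strong Markov property and the binomial theorem turn this into a linear equation for the moments
  of the passage from \<open>k\<close>; it determines them because the return probability to \<open>k\<close> is less than 1
  and the moments are finite, which follows by truncating the number of steps.  At level \<open>m\<close>, where
  \<open>S = {0}\<close>, the first passage time is the hitting time.  Since the recurrent algorithm has a unique
  solution, its result is this hitting time moment for every exclusion order.
\<close>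

subsection \<open>First passages of a trajectory\<close>

text \<open>The Markov hypothesis concerns a single step and events \<open>X (Suc n) \<le> t\<close>
  with t \<ge> 0, whereas a passage depends on the whole trajectory. It therefore has to be lifted
  to nonnegative measurable functionals of the shifted trajectory, and then to the random index of a
  first visit. Passages are read off \<open>future 0\<close>, which drops index 0: "first visit
  after time 0" becomes "least index", and the start state enters only through \<open>P i\<close>.
  State 0 is never excluded, so almost sure infinite recurrence of 0 makes all \<open>LEAST\<close>
  terms genuine; it follows from a maximum principle for the probability of never reaching 0. In
  \<open>ennreal\<close> the equation x = a + p * x has the spurious solution \<infinity> when p >
  0, so the moments cannot be computed before they are known to be finite. Truncation counts steps
  because every detour through the excluded state uses at least one: the truncated moments then
  satisfy a recursive inequality that starts at 0.\<close>

definition hit :: "nat set \<Rightarrow> (nat \<Rightarrow> nat \<times> real) \<Rightarrow> nat" where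
  "hit S z = (LEAST n. fst (z n) \<in> S)"

definition place :: "nat set \<Rightarrow> (nat \<Rightarrow> nat \<times> real) \<Rightarrow> nat" where
  "place S z = fst (z (hit S z))"

text \<open>The upper end is included because the second component of \<open>z l\<close> is the
  duration of the transition into \<open>fst (z l)\<close>.\<close>

definition elapsed :: "nat set \<Rightarrow> (nat \<Rightarrow> nat \<times> real) \<Rightarrow> real" where
  "elapsed S z = (\<Sum>l\<le>hit S z. snd (z l))"

lemma place_in: "\<exists>n. fst (z n) \<in> S \<Longrightarrow> place S z \<in> S"
  unfolding place_def hit_def by (rule LeastI_ex)

lemma before_hit: "n < hit S z \<Longrightarrow> fst (z n) \<notin> S"
  unfolding hit_def by (rule not_less_Least)

lemma hit_eqI: "fst (z n) \<in> S \<Longrightarrow> (\<And>l. l < n \<Longrightarrow> fst (z l) \<notin> S) \<Longrightarrow> hit S z = n"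
  unfolding hit_def by (rule Least_equality) (auto simp: not_less[symmetric])

lemma hit_le: "fst (z n) \<in> S \<Longrightarrow> hit S z \<le> n"
  unfolding hit_def by (rule Least_le)

lemma hit_remove:
  assumes "\<exists>n. fst (z n) \<in> S" "place S z \<noteq> k"
  shows "hit (S - {k}) z = hit S z"
  using place_in[OF assms(1)] assms(2) by (intro hit_eqI) (auto simp: place_def dest: before_hit)

lemma hit_shift:
  assumes "\<And>l. l < n \<Longrightarrow> fst (z l) \<notin> S" "\<exists>l. fst (z (n + l)) \<in> S"
  shows "hit S z = n + hit S (\<lambda>l. z (n + l))"
proof (rule hit_eqI)
  show "fst (z (n + hit S (\<lambda>l. z (n + l)))) \<in> S"
    using place_in[of "\<lambda>l. z (n + l)"] assms(2) by (simp add: place_def)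
  show "fst (z l) \<notin> S" if "l < n + hit S (\<lambda>l. z (n + l))" for l
    using before_hit[of "l - n" S "\<lambda>l. z (n + l)"] assms(1)[of l] that by (cases "l < n") auto
qed

text \<open>The restart is at \<open>Suc (hit S z)\<close>: the visit at \<open>hit S z\<close> is
  to k, outside \<open>S - {k}\<close>, and the restarted trajectory has to omit its own start
  state.\<close>

lemma hit_remove_shift:
  assumes "place S z = k" "\<exists>n. fst (z (Suc (hit S z) + n)) \<in> S - {k}"
  shows "hit (S - {k}) z = Suc (hit S z) + hit (S - {k}) (\<lambda>n. z (Suc (hit S z) + n))"
  using assms before_hit[of _ S z] by (intro hit_shift) (auto simp: less_Suc_eq place_def)

lemma place_remove_shift:
  assumes "place S z = k" "\<exists>n. fst (z (Suc (hit S z) + n)) \<in> S - {k}"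
  shows "place (S - {k}) z = place (S - {k}) (\<lambda>n. z (Suc (hit S z) + n))"
  unfolding place_def hit_remove_shift[OF assms] by simp

lemma elapsed_remove_shift:
  assumes "place S z = k" "\<exists>n. fst (z (Suc (hit S z) + n)) \<in> S - {k}"
  shows "elapsed (S - {k}) z
    = elapsed S z + elapsed (S - {k}) (\<lambda>n. z (Suc (hit S z) + n))"
proof -
  have "(\<Sum>l\<le>Suc a + b. f l) = (\<Sum>l\<le>a. f l) + (\<Sum>l\<le>b. f (Suc a + l))" for a b and f :: "nat \<Rightarrow> real"
    by (induction b) (auto simp: ac_simps)
  then show ?thesis
    unfolding elapsed_def hit_remove_shift[OF assms] by simp
qed

subsection \<open>Visits and excluded states\<close>

context
  fixes S :: "nat set" and j :: "nat \<Rightarrow> nat"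
  assumes infinite_visits: "\<forall>n. \<exists>r>n. j r \<in> S"
begin

lemma visit_Suc:
  "visit S j n < visit S j (Suc n)" "j (visit S j (Suc n)) \<in> S"
  using LeastI_ex[OF infinite_visits[rule_format, of "visit S j n"]] by auto

lemma strict_mono_visit: "strict_mono (visit S j)"
  by (simp add: strict_mono_Suc_iff visit_Suc(1) del: visit.simps)

text \<open>For the least n with r \<le> \<open>visit S j n\<close>, the preceding visit lies before
  r, so r competes in the \<open>LEAST\<close> that defines visit n.\<close>

lemma visit_exhaust:
  assumes "0 < r" "j r \<in> S"
  obtains n where "0 < n" "r = visit S j n"
proof -
  define n where "n = (LEAST n. r \<le> visit S j n)"
  have ex: "r \<le> visit S j r"
    by (rule strict_mono_imp_increasing[OF strict_mono_visit])
  have n: "r \<le> visit S j n"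
    unfolding n_def by (rule LeastI[where P = "\<lambda>n. r \<le> visit S j n", OF ex])
  then obtain n' where n': "n = Suc n'"
    using assms(1) by (cases n) auto
  then have "visit S j n' < r"
    using not_less_Least[of n' "\<lambda>n. r \<le> visit S j n"] n_def by auto
  then have "visit S j n \<le> r"
    using assms(2) n' by (auto intro: Least_le)
  then have "r = visit S j n" using n by (rule antisym[rotated])
  then show thesis using that[of n] n' by blast
qed

end

lemma infinite_visits_mono: "\<forall>n. \<exists>r>n. j r \<in> S \<Longrightarrow> S \<subseteq> S' \<Longrightarrow> \<forall>n. \<exists>r>n. j r \<in> S'"
  by blast

lemma infinite_visits_visit:
  fixes j :: "nat \<Rightarrow> nat"
  assumes "\<forall>n. \<exists>r>n. j r \<in> S'" "S' \<subseteq> S"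
  shows "\<forall>n. \<exists>r>n. j (visit S j r) \<in> S'"
proof
  fix n
  have S: "\<forall>n. \<exists>r>n. j r \<in> S" using assms by blast
  obtain r where r: "r > visit S j n" "j r \<in> S'" using assms(1) by blast
  then obtain s where "r = visit S j s"
    using visit_exhaust[OF S, of r] assms(2) by (metis not_gr_zero not_less_zero subsetD)
  then show "\<exists>r>n. j (visit S j r) \<in> S'"
    using r strict_mono_less[OF strict_mono_visit[OF S]] by auto
qed

text \<open>Since S' \<subseteq> S, thinning to S skips no visit to S'. Both sides therefore pick
  the next index in S' after the same previous one.\<close>

lemma visit_visit:
  fixes j :: "nat \<Rightarrow> nat"
  assumes inf: "\<forall>n. \<exists>r>n. j r \<in> S'" and sub: "S' \<subseteq> S"
  shows "visit S j (visit S' (\<lambda>n. j (visit S j n)) n) = visit S' j n"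
proof (induction n)
  case (Suc n)
  let ?V = "visit S j" and ?V' = "visit S' (\<lambda>n. j (visit S j n))"
  have S: "\<forall>n. \<exists>r>n. j r \<in> S" using assms by blast
  note less = strict_mono_less[OF strict_mono_visit[OF S]]
    and le = strict_mono_less_eq[OF strict_mono_visit[OF S]]
  note V' = visit_Suc[OF infinite_visits_visit[OF inf sub], of n]
  have "visit S' j (Suc n) = ?V (?V' (Suc n))"
    unfolding visit.simps(2)[of S' j]
  proof (rule Least_equality)
    show "visit S' j n < ?V (?V' (Suc n)) \<and> j (?V (?V' (Suc n))) \<in> S'"
      using V' unfolding Suc[symmetric] less by blast
    fix r assume r: "visit S' j n < r \<and> j r \<in> S'"
    then obtain s where s: "r = ?V s"
      using visit_exhaust[OF S, of r] sub by (metis not_gr_zero not_less_zero subsetD)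
    then have "?V' n < s" using r less[of "?V' n" s] unfolding Suc[symmetric] by blast
    then have "?V' (Suc n) \<le> s" using r s by (auto intro: Least_le)
    then show "?V (?V' (Suc n)) \<le> r" using s le by blast
  qed
  then show ?case by (simp del: visit.simps)
qed simp

lemma phase_space_Suc: "phase_space m k (Suc n) = phase_space m k n - {k (Suc n)}"
  by (auto simp: phase_space_def atLeastAtMostSuc_conv)

text \<open>Waiting times of a reduced process are block sums; this merges the blocks when a further
  exclusion adds them up.\<close>

lemma sum_greaterThanAtMost_partition:
  fixes f :: "nat \<Rightarrow> real" and a b :: nat
  assumes "mono V" "a \<le> b"
  shows "(\<Sum>r\<in>{a<..b}. \<Sum>l\<in>{V (r - 1)<..V r}. f l) = (\<Sum>l\<in>{V a<..V b}. f l)"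
  using assms(2)
proof (induction b rule: dec_induct)
  case (step b)
  have "{a<..Suc b} = insert (Suc b) {a<..b}" using step by auto
  moreover have "{V a<..V (Suc b)} = {V a<..V b} \<union> {V b<..V (Suc b)}"
    using monoD[OF assms(1), of a b] monoD[OF assms(1), of b "Suc b"] step by auto
  moreover have "{V a<..V b} \<inter> {V b<..V (Suc b)} = {}" by auto
  ultimately show ?case using step by (simp add: sum.union_disjoint)
qed simp

text \<open>Successive thinnings compose: \<open>visit_visit\<close> handles the indices and the
  merging of blocks handles the times. The guard \<open>0 < l\<close> is forced by level 0, where
  \<open>reduced\<close> keeps the given \<open>snd (z 0)\<close>, while the block sum at l = 0 is
  empty.\<close>

lemma reduced_eq:
  fixes z :: "nat \<Rightarrow> nat \<times> real"
  assumes range: "\<And>l. fst (z l) \<le> m"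
    and inf: "\<forall>r. \<exists>l>r. fst (z l) \<in> phase_space m k n"
  defines "V \<equiv> \<lambda>n. visit (phase_space m k n) (\<lambda>l. fst (z l))"
  shows "fst (reduced m k n z l) = fst (z (V n l)) \<and>
    (0 < l \<longrightarrow> snd (reduced m k n z l) = (\<Sum>r\<in>{V n (l - 1)<..V n l}. snd (z r)))"
  using inf
proof (induction n arbitrary: l)
  case 0
  have "visit (phase_space m k 0) (\<lambda>l. fst (z l)) l = l" for l
    using range by (induction l) (auto simp: phase_space_def intro: Least_equality)
  moreover have "{l - 1<..l} = {l}" if "0 < l" using that by auto
  ultimately show ?case by (simp add: V_def)
next
  case (Suc n)
  let ?S = "phase_space m k n" and ?S' = "phase_space m k (Suc n)" and ?j = "\<lambda>l. fst (z l)"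
  have sub: "?S' \<subseteq> ?S" by (auto simp: phase_space_Suc)
  have infS: "\<forall>r. \<exists>l>r. fst (z l) \<in> ?S" using infinite_visits_mono[OF Suc.prems sub] .
  note IH = Suc.IH[OF infS]
  define W where "W = visit ?S' (\<lambda>l. fst (reduced m k n z l))"
  have W_eq: "W = visit ?S' (\<lambda>l. ?j (V n l))" unfolding W_def using IH by simp
  have VW: "V n (W l) = V (Suc n) l" for l
    unfolding W_eq V_def by (rule visit_visit[OF Suc.prems sub])
  have W_mono: "mono W"
    unfolding W_eq V_def
    by (intro strict_mono_mono strict_mono_visit infinite_visits_visit[OF Suc.prems sub])
  have V_mono: "mono (V n)"
    unfolding V_def by (intro strict_mono_mono strict_mono_visit infS)
  have red: "reduced m k (Suc n) z l = (if l = 0 then (fst (reduced m k n z 0), 0)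
      else (fst (reduced m k n z (W l)), \<Sum>r\<in>{W (l - 1)<..W l}. snd (reduced m k n z r)))"
    by (simp add: exclude_def Let_def W_def phase_space_Suc)
  have "(\<Sum>r\<in>{W (l - 1)<..W l}. snd (reduced m k n z r))
      = (\<Sum>r\<in>{W (l - 1)<..W l}. \<Sum>s\<in>{V n (r - 1)<..V n r}. snd (z s))"
    using IH by (intro sum.cong) auto
  also have "\<dots> = (\<Sum>s\<in>{V (Suc n) (l - 1)<..V (Suc n) l}. snd (z s))"
    by (subst sum_greaterThanAtMost_partition[OF V_mono monoD[OF W_mono]]) (simp_all add: VW)
  finally show ?case
    using IH[of "W l"] IH[of 0] unfolding red VW by (simp add: V_def)
qed

text \<open>The shift by one turns "after time 0" into "least index". The sequence x is arbitrary,
  as \<open>hit\<close> looks at first components only.\<close>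

lemma visit_one_hit:
  assumes "\<exists>r>0. j r \<in> S"
  shows "visit S j 1 = Suc (hit S (\<lambda>n. (j (Suc n), x n)))"
proof -
  obtain r where "j (Suc r) \<in> S" using assms gr0_implies_Suc by blast
  then have "j (Suc (hit S (\<lambda>n. (j (Suc n), x n)))) \<in> S"
    using place_in[of "\<lambda>n. (j (Suc n), x n)" S] by (auto simp: place_def)
  moreover have "Suc (hit S (\<lambda>n. (j (Suc n), x n))) \<le> r" if "0 < r" "j r \<in> S" for r
    using that hit_le[of "\<lambda>n. (j (Suc n), x n)" "r - 1" S] by auto
  ultimately show ?thesis
    unfolding One_nat_def visit.simps by (intro Least_equality) auto
qed

lemma reduced_one:
  fixes z :: "nat \<Rightarrow> nat \<times> real"
  assumes range: "\<And>l. fst (z l) \<le> m"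
    and inf: "\<forall>r. \<exists>l>r. fst (z l) \<in> phase_space m k n"
  shows "reduced m k n z 1
    = (place (phase_space m k n) (\<lambda>l. z (Suc l)), elapsed (phase_space m k n) (\<lambda>l. z (Suc l)))"
proof -
  let ?S = "phase_space m k n"
  have V: "visit ?S (\<lambda>l. fst (z l)) (Suc 0) = Suc (hit ?S (\<lambda>l. z (Suc l)))"
    using visit_one_hit[of "\<lambda>l. fst (z l)" ?S "\<lambda>l. snd (z (Suc l))"] inf by auto
  have "(\<Sum>r\<in>{0<..Suc h}. snd (z r)) = (\<Sum>l\<le>h. snd (z (Suc l)))" for h
    by (rule sum.reindex_bij_witness[of _ Suc "\<lambda>r. r - 1"]) auto
  then show ?thesis
    using reduced_eq[OF range inf, of 1] unfolding prod_eq_iff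
    by (simp add: V place_def elapsed_def del: visit.simps(2))
qed

section \<open>Hitting time of the semi-Markov process\<close>

text \<open>Positive durations make the jump times strictly increasing, so exactly h jumps have
  occurred at \<open>jump_time x h\<close> and the state there is 0. An earlier t \<ge>
  \<open>x 1\<close> sees a state whose index lies between 1 and h - 1, and none of these is
  0.\<close>

lemma hitting_time_eq:
  fixes j :: "nat \<Rightarrow> nat" and x :: "nat \<Rightarrow> real"
  assumes pos: "\<And>n. 0 < x (Suc n)" and hits: "\<exists>n. j (Suc n) = 0"
  shows "hitting_time j x = ennreal (elapsed {0} (\<lambda>n. (j (Suc n), x (Suc n))))"
proof -
  define h where "h = Suc (hit {0} (\<lambda>n. (j (Suc n), x (Suc n))))"
  have T_Suc: "jump_time x (Suc n) = jump_time x n + x (Suc n)" for n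
    by (simp add: jump_time_def)
  have T: "strict_mono (jump_time x)"
    by (simp add: strict_mono_Suc_iff T_Suc pos)
  have elapsed: "elapsed {0} (\<lambda>n. (j (Suc n), x (Suc n))) = jump_time x h"
    unfolding elapsed_def jump_time_def h_def
    by (rule sum.reindex_bij_witness[of _ "\<lambda>r. r - 1" Suc]) auto
  have jh: "j h = 0"
    using place_in[of "\<lambda>n. (j (Suc n), x (Suc n))" "{0}"] hits by (auto simp: place_def h_def)
  have before: "j n \<noteq> 0" if "1 \<le> n" "n < h" for n
    using before_hit[of "n - 1" "{0}" "\<lambda>n. (j (Suc n), x (Suc n))"] that by (auto simp: h_def)
  have "jump_count x (jump_time x h) = h"
    unfolding jump_count_def strict_mono_less_eq[OF T] by (rule Max_eqI) auto
  then have mem: "x 1 \<le> jump_time x h" "semi_markov j x (jump_time x h) = 0"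
    using jh strict_mono_less_eq[OF T, of 1 h]
    by (auto simp: semi_markov_def jump_time_def h_def)
  have "jump_time x h \<le> t" if t: "x 1 \<le> t" "semi_markov j x t = 0" for t
  proof (rule ccontr)
    assume "\<not> jump_time x h \<le> t"
    \<comment> \<open>Before \<open>jump_time x h\<close> the set of past jumps is bounded by h, so
      \<open>Max\<close> is genuine here even if the jump times accumulate later.\<close>
    then have sub: "{n. jump_time x n \<le> t} \<subseteq> {..<h}"
      using strict_mono_less[OF T] by (auto simp: not_le) (metis le_less_trans)
    then have fin: "finite {n. jump_time x n \<le> t}" by (rule finite_subset) simp
    have "jump_time x 1 \<le> t" using t(1) by (simp add: jump_time_def)
    then have "1 \<le> jump_count x t" "jump_count x t \<in> {n. jump_time x n \<le> t}"
      unfolding jump_count_def using Max_ge[OF fin, of 1] Max_in[OF fin] by blast+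
    then show False using before[of "jump_count x t"] sub t(2) by (auto simp: semi_markov_def)
  qed
  then have "hitting_time j x = ennreal (jump_time x h)"
    unfolding hitting_time_def using mem
    by (intro antisym INF_lower2[of "jump_time x h"] INF_greatest) (auto intro!: ennreal_leI)
  then show ?thesis by (simp add: elapsed)
qed

subsection \<open>The space of trajectories\<close>

definition path_space :: "(nat \<Rightarrow> nat \<times> real) measure" where
  "path_space = (\<Pi>\<^sub>M n\<in>UNIV. count_space UNIV \<Otimes>\<^sub>M borel)"

lemma measurable_path_component [measurable]:
  "(\<lambda>z. z n) \<in> path_space \<rightarrow>\<^sub>M count_space UNIV \<Otimes>\<^sub>M borel"
  unfolding path_space_def by measurable

lemma measurable_hit [measurable]: "hit S \<in> path_space \<rightarrow>\<^sub>M count_space UNIV"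
  unfolding hit_def by measurable

lemma measurable_place [measurable]: "place S \<in> path_space \<rightarrow>\<^sub>M count_space UNIV"
  unfolding place_def by (rule measurable_compose_countable[OF _ measurable_hit]) measurable

lemma measurable_elapsed [measurable]: "elapsed S \<in> borel_measurable path_space"
  unfolding elapsed_def by (rule measurable_compose_countable[OF _ measurable_hit]) measurable

context markov_renewal_process
begin

lemma space_P: "i \<le> m \<Longrightarrow> space (P i) = space \<Omega>"
  using sets_P by (rule sets_eq_imp_space_eq)

lemma J_le: "\<omega> \<in> space \<Omega> \<Longrightarrow> J n \<omega> \<le> m"
  using measurable_space[OF measurable_J] by auto

lemma measurable_J_UNIV [measurable]: "J n \<in> \<Omega> \<rightarrow>\<^sub>M count_space UNIV"
  by (rule measurable_compose[OF measurable_J]) simp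

declare measurable_X [measurable]

text \<open>Index 0 is time n + 1. Leaving out \<open>J n\<close> makes this trajectory, given
  \<open>J n = q\<close>, distributed as \<open>future 0\<close> under \<open>P q\<close>.\<close>

definition future :: "nat \<Rightarrow> 'a \<Rightarrow> nat \<Rightarrow> nat \<times> real" where
  "future n \<omega> l = (J (Suc (n + l)) \<omega>, X (Suc (n + l)) \<omega>)"

lemma measurable_future [measurable]: "future n \<in> \<Omega> \<rightarrow>\<^sub>M path_space"
proof -
  have "(\<lambda>\<omega>. future n \<omega> l) \<in> \<Omega> \<rightarrow>\<^sub>M count_space UNIV \<Otimes>\<^sub>M borel" for l
    unfolding future_def by measurable
  then show ?thesis
    unfolding path_space_def by (intro measurable_PiM_single') (auto simp: space_pair_measure)
qed

subsection \<open>The natural filtration\<close>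

abbreviation past :: "nat \<Rightarrow> 'a measure" where
  "past \<equiv> history m \<Omega> J X"

lemma history_fun_space:
  "(\<lambda>\<omega>. \<lambda>l\<in>{..n}. (J l \<omega>, X l \<omega>))
    \<in> space \<Omega> \<rightarrow> space (\<Pi>\<^sub>M l\<in>{..n}. count_space {0..m} \<Otimes>\<^sub>M (borel :: real measure))"
  by (auto simp: space_PiM space_pair_measure J_le)

lemma space_past [simp]: "space (past n) = space \<Omega>"
  by (simp add: history_def)

lemma measurable_past_state:
  assumes "l \<le> n"
  shows "(\<lambda>\<omega>. (J l \<omega>, X l \<omega>)) \<in> past n \<rightarrow>\<^sub>M count_space {0..m} \<Otimes>\<^sub>M borel"
proof -
  have "(\<lambda>\<omega>. \<lambda>l\<in>{..n}. (J l \<omega>, X l \<omega>))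
      \<in> past n \<rightarrow>\<^sub>M (\<Pi>\<^sub>M l\<in>{..n}. count_space {0..m} \<Otimes>\<^sub>M (borel :: real measure))"
    unfolding history_def by (rule measurable_vimage_algebra1[OF history_fun_space])
  from measurable_compose[OF this measurable_component_singleton[of l]] assms
  show ?thesis by simp
qed

lemma measurable_past_J [measurable]:
  assumes "l \<le> n" shows "J l \<in> past n \<rightarrow>\<^sub>M count_space UNIV"
  using measurable_compose[OF measurable_past_state[OF assms] measurable_fst]
  by (auto intro: measurable_compose[of _ _ "count_space {0..m}"])

lemma measurable_past_X [measurable]:
  assumes "l \<le> n" shows "X l \<in> borel_measurable (past n)"
  using measurable_compose[OF measurable_past_state[OF assms] measurable_snd] by simp

lemma past_mono:
  assumes "n \<le> n'" shows "sets (past n) \<subseteq> sets (past n')"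
proof
  fix A assume "A \<in> sets (past n)"
  then obtain C where C: "C \<in> sets (\<Pi>\<^sub>M l\<in>{..n}. count_space {0..m} \<Otimes>\<^sub>M (borel :: real measure))"
    and A: "A = (\<lambda>\<omega>. \<lambda>l\<in>{..n}. (J l \<omega>, X l \<omega>)) -` C \<inter> space \<Omega>"
    unfolding history_def sets_vimage_algebra2[OF history_fun_space] by auto
  have "(\<lambda>\<omega>. \<lambda>l\<in>{..n}. (J l \<omega>, X l \<omega>))
      \<in> past n' \<rightarrow>\<^sub>M (\<Pi>\<^sub>M l\<in>{..n}. count_space {0..m} \<Otimes>\<^sub>M (borel :: real measure))"
    using assms by (intro measurable_restrict measurable_past_state) auto
  from measurable_sets[OF this C] show "A \<in> sets (past n')" by (simp add: A)
qed

lemma past_subset: "sets (past n) \<subseteq> sets \<Omega>"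
proof
  fix A assume "A \<in> sets (past n)"
  then obtain C where C: "C \<in> sets (\<Pi>\<^sub>M l\<in>{..n}. count_space {0..m} \<Otimes>\<^sub>M (borel :: real measure))"
    and A: "A = (\<lambda>\<omega>. \<lambda>l\<in>{..n}. (J l \<omega>, X l \<omega>)) -` C \<inter> space \<Omega>"
    unfolding history_def sets_vimage_algebra2[OF history_fun_space] by auto
  have "(\<lambda>\<omega>. \<lambda>l\<in>{..n}. (J l \<omega>, X l \<omega>))
      \<in> \<Omega> \<rightarrow>\<^sub>M (\<Pi>\<^sub>M l\<in>{..n}. count_space {0..m} \<Otimes>\<^sub>M (borel :: real measure))"
    using measurable_J by (intro measurable_restrict measurable_Pair measurable_X) auto
  from measurable_sets[OF this C] show "A \<in> sets \<Omega>" by (simp add: A)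
qed

lemma subalgebra_past: "subalgebra \<Omega> (past n)"
  using past_subset by (simp add: subalgebra_def)

subsection \<open>The Markov property\<close>

text \<open>A conditional expectation can be integrated over A, an event of the past; on A its value
  \<open>Q (J n) j t\<close> is the constant \<open>Q q j t\<close>.\<close>

lemma markov_step_atMost:
  assumes i: "i \<le> m" and q: "q \<le> m" and j: "j \<le> m" and t: "0 \<le> t"
    and A: "A \<in> sets (past n)" "A \<subseteq> {\<omega>. J n \<omega> = q}"
  shows "measure (P i) (A \<inter> {\<omega> \<in> space \<Omega>. J (Suc n) \<omega> = j \<and> X (Suc n) \<omega> \<le> t})
    = measure (P i) A * Q q j t"
proof -
  interpret prob_space "P i" using i by (rule prob_space_P)
  note sets_P[OF i, measurable_cong]
  have sub: "subalgebra (P i) (past n)"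
    using past_subset by (simp add: subalgebra_def sets_P space_P i)
  interpret finite_measure_subalgebra "P i" "past n"
    by unfold_locales (rule sub)
  let ?B = "{\<omega> \<in> space \<Omega>. J (Suc n) \<omega> = j \<and> X (Suc n) \<omega> \<le> t}"
  have [measurable]: "A \<in> sets \<Omega>" using A past_subset by auto
  have int: "integrable (P i) (indicator ?B :: 'a \<Rightarrow> real)"
    by (rule integrable_const_bound[of _ 1]) (auto simp: indicator_def)
  have "measure (P i) (A \<inter> ?B) = (\<integral>\<omega>\<in>A. indicator ?B \<omega> \<partial>P i)"
    by (simp add: set_lebesgue_integral_def indicator_inter_arith[symmetric])
  also have "\<dots> = (\<integral>\<omega>\<in>A. real_cond_exp (P i) (past n) (indicator ?B) \<omega> \<partial>P i)"
    by (rule real_cond_exp_intA[OF int A(1)])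
  also have "\<dots> = (\<integral>\<omega>\<in>A. Q q j t \<partial>P i)"
    unfolding set_lebesgue_integral_def
  proof (rule integral_cong_AE)
    show "AE \<omega> in P i. indicator A \<omega> *\<^sub>R real_cond_exp (P i) (past n) (indicator ?B) \<omega>
        = indicator A \<omega> *\<^sub>R Q q j t"
      using markov[OF i j t, of n] by eventually_elim (use A(2) in \<open>auto simp: indicator_def\<close>)
  qed simp_all
  also have "\<dots> = measure (P i) A * Q q j t"
    by (simp add: set_lebesgue_integral_def)
  finally show ?thesis .
qed

text \<open>The Markov property at n = 0 under \<open>P q\<close>, where \<open>J 0 = q\<close> has
  full measure. It trades Q for the law of the first step.\<close>

lemma Q_eq:
  assumes q: "q \<le> m" and j: "j \<le> m" and t: "0 \<le> t"
  shows "Q q j t = measure (P q) {\<omega> \<in> space \<Omega>. J 1 \<omega> = j \<and> X 1 \<omega> \<le> t}"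
proof -
  interpret prob_space "P q" using q by (rule prob_space_P)
  note sets_P[OF q, measurable_cong]
  let ?A = "{\<omega> \<in> space \<Omega>. J 0 \<omega> = q}" and ?B = "{\<omega> \<in> space \<Omega>. J 1 \<omega> = j \<and> X 1 \<omega> \<le> t}"
  have A: "?A \<in> sets (past 0)"
    using measurable_sets[OF measurable_past_J[of 0 0], of "{q}"]
    by (simp add: vimage_def Int_def conj_commute)
  have "measure (P q) ?A = 1"
    using initial[OF q] by (subst prob_eq_1) (auto simp: space_P[OF q, symmetric])
  moreover have "measure (P q) (?A \<inter> ?B) = measure (P q) ?B"
    using initial[OF q] by (intro measure_eq_AE) auto
  moreover have "?A \<subseteq> {\<omega>. J 0 \<omega> = q}" by auto
  ultimately show ?thesis
    using markov_step_atMost[OF q q j t A] by simp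
qed

text \<open>As functions of C both sides are finite Borel measures on the line, hence determined by
  their distribution functions.\<close>

lemma markov_step_Collect:
  assumes i: "i \<le> m" and q: "q \<le> m" and j: "j \<le> m"
    and A: "A \<in> sets (past n)" "A \<subseteq> {\<omega>. J n \<omega> = q}" and C: "C \<in> sets borel"
  shows "emeasure (P i) (A \<inter> {\<omega> \<in> space \<Omega>. J (Suc n) \<omega> = j \<and> X (Suc n) \<omega> \<in> C})
    = emeasure (P i) A * emeasure (P q) {\<omega> \<in> space \<Omega>. J 1 \<omega> = j \<and> X 1 \<omega> \<in> C}"
proof -
  interpret prob_space "P i" using i by (rule prob_space_P)
  interpret q: prob_space "P q" using q by (rule prob_space_P)
  note sets_P[OF i, measurable_cong] sets_P[OF q, measurable_cong]
  have [measurable]: "A \<in> sets \<Omega>" using A past_subset by auto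
  define M1 where "M1 = distr (density (P i) (indicator (A \<inter> {\<omega> \<in> space \<Omega>. J (Suc n) \<omega> = j})))
    borel (X (Suc n))"
  define M2 where "M2 = scale_measure (emeasure (P i) A)
    (distr (density (P q) (indicator {\<omega> \<in> space \<Omega>. J 1 \<omega> = j})) borel (X 1))"
  have M1: "emeasure M1 C = emeasure (P i) (A \<inter> {\<omega> \<in> space \<Omega>. J (Suc n) \<omega> = j \<and> X (Suc n) \<omega> \<in> C})"
    if [measurable]: "C \<in> sets borel" for C
  proof -
    have "A \<inter> {\<omega> \<in> space \<Omega>. J (Suc n) \<omega> = j} \<inter> (X (Suc n) -` C \<inter> space \<Omega>)
        = A \<inter> {\<omega> \<in> space \<Omega>. J (Suc n) \<omega> = j \<and> X (Suc n) \<omega> \<in> C}" by auto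
    then show ?thesis
      by (simp only: M1_def) (simp add: emeasure_distr emeasure_restricted space_P i)
  qed
  have M2: "emeasure M2 C = emeasure (P i) A * emeasure (P q) {\<omega> \<in> space \<Omega>. J 1 \<omega> = j \<and> X 1 \<omega> \<in> C}"
    if [measurable]: "C \<in> sets borel" for C
  proof -
    have "{\<omega> \<in> space \<Omega>. J 1 \<omega> = j} \<inter> (X 1 -` C \<inter> space \<Omega>)
        = {\<omega> \<in> space \<Omega>. J 1 \<omega> = j \<and> X 1 \<omega> \<in> C}" by auto
    then show ?thesis
      by (simp only: M2_def) (simp add: emeasure_distr emeasure_restricted space_P q)
  qed
  have "M1 = M2"
  proof (rule cdf_unique')
    have "sets M1 = sets borel" "sets M2 = sets borel"
      by (simp_all add: M1_def M2_def)
    moreover from this[THEN sets_eq_imp_space_eq] have "space M1 = UNIV" "space M2 = UNIV"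
      by simp_all
    ultimately show "finite_borel_measure M1" "finite_borel_measure M2"
      unfolding finite_borel_measure_def finite_borel_measure_axioms_def
      by (auto intro!: finite_measureI
          simp: M1 M2 emeasure_eq_measure q.emeasure_eq_measure ennreal_mult'[symmetric])
    show "cdf M1 = cdf M2"
    proof
      fix t
      have "emeasure M1 {..t} = emeasure M2 {..t}"
      proof (cases "0 \<le> t")
        case True
        show ?thesis
          using markov_step_atMost[OF i q j True A] Q_eq[OF q j True]
          by (simp add: M1 M2 emeasure_eq_measure q.emeasure_eq_measure ennreal_mult'[symmetric])
      next
        \<comment> \<open>The Markov hypothesis says nothing for negative t; there both measures
          vanish because X is nonnegative.\<close>
        case False
        then have none: "{\<omega> \<in> space \<Omega>. J l \<omega> = j \<and> X l \<omega> \<in> {..t}} = {}" for l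
          using X_nonneg[of _ l] by (force simp: not_le)
        show ?thesis unfolding M1[OF atMost_borel] M2[OF atMost_borel] none by simp
      qed
      then show "cdf M1 t = cdf M2 t" by (simp add: cdf_def measure_def)
    qed
  qed
  then show ?thesis using M1[OF C] M2[OF C] by simp
qed

lemma emeasure_split_J:
  assumes "i \<le> m" and [measurable]: "A \<in> sets \<Omega>"
  shows "emeasure (P i) A = (\<Sum>q\<le>m. emeasure (P i) (A \<inter> {\<omega> \<in> space \<Omega>. J n \<omega> = q}))"
proof -
  note sets_P[OF assms(1), measurable_cong]
  have "A = (\<Union>q\<in>{..m}. A \<inter> {\<omega> \<in> space \<Omega>. J n \<omega> = q})"
    using sets.sets_into_space[OF assms(2)] by (auto simp: J_le)
  then show ?thesis
    by (subst sum_emeasure) (auto simp: disjoint_family_on_def)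
qed

lemma markov_step:
  assumes i: "i \<le> m" and q: "q \<le> m"
    and A: "A \<in> sets (past n)" "A \<subseteq> {\<omega>. J n \<omega> = q}"
    and B [measurable]: "B \<in> sets (count_space UNIV \<Otimes>\<^sub>M borel)"
  shows "emeasure (P i) (A \<inter> {\<omega> \<in> space \<Omega>. future n \<omega> 0 \<in> B})
    = emeasure (P i) A * emeasure (P q) {\<omega> \<in> space \<Omega>. future 0 \<omega> 0 \<in> B}"
proof -
  have [measurable]: "{\<omega> \<in> space \<Omega>. future n \<omega> 0 \<in> B} \<in> sets \<Omega>" for n
    unfolding future_def by measurable
  have sets: "A \<inter> {\<omega> \<in> space \<Omega>. future n \<omega> 0 \<in> B} \<in> sets \<Omega>"
    using A past_subset by (intro sets.Int) auto
  have slice: "A' \<inter> {\<omega> \<in> space \<Omega>. future n \<omega> 0 \<in> B} \<inter> {\<omega> \<in> space \<Omega>. J (Suc n) \<omega> = j}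
      = A' \<inter> {\<omega> \<in> space \<Omega>. J (Suc n) \<omega> = j \<and> X (Suc n) \<omega> \<in> Pair j -` B}" for A' n j
    by (auto simp: future_def)
  have "emeasure (P i) (A \<inter> {\<omega> \<in> space \<Omega>. future n \<omega> 0 \<in> B})
    = (\<Sum>j\<le>m. emeasure (P i) A * emeasure (P q) {\<omega> \<in> space \<Omega>. J 1 \<omega> = j \<and> X 1 \<omega> \<in> Pair j -` B})"
    unfolding emeasure_split_J[OF i sets, of "Suc n"] slice
    by (intro sum.cong refl markov_step_Collect i q A sets_Pair1[OF B]) simp
  also have "\<dots> = emeasure (P i) A * emeasure (P q) {\<omega> \<in> space \<Omega>. future 0 \<omega> 0 \<in> B}"
  proof -
    have "{\<omega> \<in> space \<Omega>. future 0 \<omega> 0 \<in> B} \<inter> {\<omega> \<in> space \<Omega>. J 1 \<omega> = j}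
        = {\<omega> \<in> space \<Omega>. J 1 \<omega> = j \<and> X 1 \<omega> \<in> Pair j -` B}" for j
      by (auto simp: future_def)
    then show ?thesis
      by (subst emeasure_split_J[OF q, of _ 1]) (simp_all add: sum_distrib_left)
  qed
  finally show ?thesis .
qed

text \<open>Induction on the number of coordinates, splitting by the state p at time n + N. The
  first N coordinates together with p form an event of \<open>past (n + N)\<close>, so the one-step
  property produces the last coordinate.\<close>

lemma markov_cylinder:
  assumes i: "i \<le> m" and q: "q \<le> m"
    and A: "A \<in> sets (past n)" "A \<subseteq> {\<omega>. J n \<omega> = q}"
    and B: "\<And>l. B l \<in> sets (count_space UNIV \<Otimes>\<^sub>M borel)"
  shows "emeasure (P i) (A \<inter> {\<omega> \<in> space \<Omega>. \<forall>l<N. future n \<omega> l \<in> B l})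
    = emeasure (P i) A * emeasure (P q) {\<omega> \<in> space \<Omega>. \<forall>l<N. future 0 \<omega> l \<in> B l}"
  using B
proof (induction N arbitrary: B)
  case 0
  interpret prob_space "P q" using q by (rule prob_space_P)
  show ?case using sets.sets_into_space[OF A(1)] emeasure_space_1
    by (simp add: Int_absorb2 space_P q)
next
  case (Suc N)
  interpret q: prob_space "P q" using q by (rule prob_space_P)
  note sets_P[OF q, measurable_cong]
  have B [measurable]: "B l \<in> sets (count_space UNIV \<Otimes>\<^sub>M borel)" for l by (rule Suc.prems)
  define E where "E n p = {\<omega> \<in> space \<Omega>. (\<forall>l<N. future n \<omega> l \<in> B l) \<and> J (n + N) \<omega> = p}" for n p
  have E: "E n p \<in> sets (past (n + N))" for n p
  proof -
    have "{\<omega> \<in> space (past (n + N)). (\<forall>l\<in>{..<N}. (J (Suc (n + l)) \<omega>, X (Suc (n + l)) \<omega>) \<in> B l)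
        \<and> J (n + N) \<omega> = p} \<in> sets (past (n + N))"
      by measurable auto
    then show ?thesis by (simp only: E_def future_def Ball_def lessThan_iff space_past)
  qed
  have [measurable]: "E n p \<in> sets \<Omega>" for n p by (rule subsetD[OF past_subset E])
  have [measurable]: "{\<omega> \<in> space \<Omega>. \<forall>l<Suc N. future n \<omega> l \<in> B l} \<in> sets \<Omega>" for n
    unfolding future_def by measurable
  have sets: "A \<inter> {\<omega> \<in> space \<Omega>. \<forall>l<Suc N. future n \<omega> l \<in> B l} \<in> sets \<Omega>"
    using A past_subset by (intro sets.Int) auto
  have split: "A' \<inter> {\<omega> \<in> space \<Omega>. \<forall>l<Suc N. future n \<omega> l \<in> B l} \<inter> {\<omega> \<in> space \<Omega>. J (n + N) \<omega> = p}
      = A' \<inter> E n p \<inter> {\<omega> \<in> space \<Omega>. future (n + N) \<omega> 0 \<in> B N}" for A' n p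
    by (auto simp: E_def less_Suc_eq future_def)
  \<comment> \<open>The side condition \<open>J (n + N) = p\<close> has to fit the induction
    hypothesis. For N = 0 it concerns \<open>J n\<close>, which is fixed by A on one side and by the
    initial law on the other; otherwise it is absorbed into the set for coordinate N - 1.\<close>
  have AE: "emeasure (P i) (A \<inter> E n p) = emeasure (P i) A * emeasure (P q) (E 0 p)" if "p \<le> m" for p
  proof (cases N)
    case 0
    have "A \<inter> E n p = (if p = q then A else {})"
      using A(2) sets.sets_into_space[OF A(1)] by (auto simp: E_def 0)
    moreover have "emeasure (P q) (E 0 p) = (if p = q then 1 else 0)"
    proof (cases "p = q")
      case True
      then have "emeasure (P q) (E 0 p) = emeasure (P q) (space (P q))"
        using initial[OF q] by (intro emeasure_eq_AE) (auto simp: E_def 0 space_P q)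
      then show ?thesis using True q.emeasure_space_1 by simp
    next
      case False
      then have "emeasure (P q) (E 0 p) = emeasure (P q) {}"
        using initial[OF q] by (intro emeasure_eq_AE) (auto simp: E_def 0)
      then show ?thesis using False by simp
    qed
    ultimately show ?thesis by simp
  next
    case (Suc N')
    let ?B = "B(N' := B N' \<inter> {p} \<times> UNIV)"
    have E_eq: "E n p = {\<omega> \<in> space \<Omega>. \<forall>l<N. future n \<omega> l \<in> ?B l}" for n
      by (auto simp: E_def Suc less_Suc_eq future_def)
    have "?B l \<in> sets (count_space UNIV \<Otimes>\<^sub>M borel)" for l
      by (auto intro!: sets.Int pair_measureI)
    from Suc.IH[OF this] show ?thesis by (simp only: E_eq)
  qed
  have step: "emeasure (P q) (E 0 p \<inter> {\<omega> \<in> space \<Omega>. future N \<omega> 0 \<in> B N})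
      = emeasure (P q) (E 0 p) * emeasure (P p) {\<omega> \<in> space \<Omega>. future 0 \<omega> 0 \<in> B N}" if "p \<le> m" for p
  proof (rule markov_step[OF q that _ _ B])
    show "E 0 p \<in> sets (past N)" using E[of 0 p] by simp
    show "E 0 p \<subseteq> {\<omega>. J N \<omega> = p}" by (auto simp: E_def)
  qed
  have "emeasure (P i) (A \<inter> {\<omega> \<in> space \<Omega>. \<forall>l<Suc N. future n \<omega> l \<in> B l})
    = (\<Sum>p\<le>m. emeasure (P i) (A \<inter> E n p) * emeasure (P p) {\<omega> \<in> space \<Omega>. future 0 \<omega> 0 \<in> B N})"
    unfolding emeasure_split_J[OF i sets, of "n + N"] split
    using subsetD[OF past_mono[of n "n + N"] A(1)]
    by (intro sum.cong refl markov_step i B sets.Int E) (auto simp: E_def)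
  also have "\<dots> = emeasure (P i) A *
      (\<Sum>p\<le>m. emeasure (P q) (E 0 p) * emeasure (P p) {\<omega> \<in> space \<Omega>. future 0 \<omega> 0 \<in> B N})"
    unfolding sum_distrib_left by (intro sum.cong refl) (simp add: AE mult.assoc)
  also have "(\<Sum>p\<le>m. emeasure (P q) (E 0 p) * emeasure (P p) {\<omega> \<in> space \<Omega>. future 0 \<omega> 0 \<in> B N})
      = (\<Sum>p\<le>m. emeasure (P q) (E 0 p \<inter> {\<omega> \<in> space \<Omega>. future (0 + N) \<omega> 0 \<in> B N}))"
    by (intro sum.cong refl) (simp add: step)
  also have "\<dots> = emeasure (P q) {\<omega> \<in> space \<Omega>. \<forall>l<Suc N. future 0 \<omega> l \<in> B l}"
  proof -
    have "{\<omega> \<in> space \<Omega>. \<forall>l<Suc N. future 0 \<omega> l \<in> B l} \<inter> {\<omega> \<in> space \<Omega>. J (0 + N) \<omega> = p}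
        = E 0 p \<inter> {\<omega> \<in> space \<Omega>. future (0 + N) \<omega> 0 \<in> B N}" for p
      by (auto simp: E_def less_Suc_eq future_def)
    then show ?thesis by (subst emeasure_split_J[OF q, of _ "0 + N"]) simp_all
  qed
  finally show ?case .
qed

text \<open>The law of the future restricted to A and the rescaled law of \<open>future 0\<close>
  under \<open>P q\<close> agree on cylinders, and cylinders determine finite measures on the
  product space.\<close>

lemma markov_shift_set:
  assumes i: "i \<le> m" and q: "q \<le> m"
    and A: "A \<in> sets (past n)" "A \<subseteq> {\<omega>. J n \<omega> = q}"
    and F [measurable]: "F \<in> borel_measurable path_space"
  shows "(\<integral>\<^sup>+\<omega>. indicator A \<omega> * F (future n \<omega>) \<partial>P i)
    = emeasure (P i) A * (\<integral>\<^sup>+\<omega>. F (future 0 \<omega>) \<partial>P q)"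
proof -
  interpret prob_space "P i" using i by (rule prob_space_P)
  interpret q: prob_space "P q" using q by (rule prob_space_P)
  note sets_P[OF i, measurable_cong] sets_P[OF q, measurable_cong]
  have [measurable]: "A \<in> sets \<Omega>" using A past_subset by auto
  let ?N = "\<lambda>_::nat. count_space UNIV \<Otimes>\<^sub>M (borel :: real measure)"
  define M1 where "M1 = distr (density (P i) (indicator A)) path_space (future n)"
  define M2 where "M2 = scale_measure (emeasure (P i) A) (distr (P q) path_space (future 0))"
  have "M1 = M2"
  proof (rule measure_eqI_PiM_infinite)
    show "sets M1 = sets (PiM UNIV ?N)" "sets M2 = sets (PiM UNIV ?N)"
      by (simp_all add: M1_def M2_def path_space_def)
    show "finite_measure M1"
      by (rule finite_measureI)
        (simp add: M1_def emeasure_distr emeasure_restricted emeasure_eq_measure)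
    fix K :: "nat set" and B :: "nat \<Rightarrow> (nat \<times> real) set"
    assume K: "finite K" and B: "\<And>l. l \<in> K \<Longrightarrow> B l \<in> sets (?N l)"
    obtain N where N: "K \<subseteq> {..<N}" using finite_nat_set_iff_bounded K by auto
    \<comment> \<open>Padding with \<open>UNIV\<close> turns conditions on the finite set K into
      conditions on an initial segment.\<close>
    define B' where "B' l = (if l \<in> K then B l else UNIV)" for l
    have B' [measurable]: "B' l \<in> sets (?N l)" for l
      using B sets.top[of "?N l"] by (auto simp: B'_def space_pair_measure)
    have emb: "prod_emb UNIV ?N K (Pi\<^sub>E K B) = {z \<in> space path_space. \<forall>l<N. z l \<in> B' l}"
      using N by (auto simp: prod_emb_def path_space_def space_PiM space_pair_measure B'_def PiE_iff)
          (meson lessThan_iff subsetD)+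
    have [measurable]: "{z \<in> space path_space. \<forall>l<N. z l \<in> B' l} \<in> sets path_space"
      by measurable
    have vimage: "future n -` {z \<in> space path_space. \<forall>l<N. z l \<in> B' l} \<inter> space \<Omega>
        = {\<omega> \<in> space \<Omega>. \<forall>l<N. future n \<omega> l \<in> B' l}" for n
      using measurable_space[OF measurable_future] by auto
    show "emeasure M1 (prod_emb UNIV ?N K (Pi\<^sub>E K B)) = emeasure M2 (prod_emb UNIV ?N K (Pi\<^sub>E K B))"
      unfolding emb using markov_cylinder[OF i q A, of B' N, OF B']
      by (simp add: M1_def M2_def emeasure_distr emeasure_restricted space_P i q vimage del: vimage_Collect_eq)
  qed
  then have "(\<integral>\<^sup>+z. F z \<partial>M1) = (\<integral>\<^sup>+z. F z \<partial>M2)" by simp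
  then show ?thesis
    by (simp add: M1_def M2_def nn_integral_distr nn_integral_density nn_integral_scale_measure)
qed

text \<open>Extension from indicators to nonnegative functions of the past; the time elapsed before
  a restart will be such a factor.\<close>

lemma markov_shift:
  assumes i: "i \<le> m" and q: "q \<le> m"
    and h: "h \<in> borel_measurable (past n)"
    and F [measurable]: "F \<in> borel_measurable path_space"
  shows "(\<integral>\<^sup>+\<omega>. h \<omega> * indicator {\<omega>. J n \<omega> = q} \<omega> * F (future n \<omega>) \<partial>P i)
    = (\<integral>\<^sup>+\<omega>. h \<omega> * indicator {\<omega>. J n \<omega> = q} \<omega> \<partial>P i) * (\<integral>\<^sup>+\<omega>. F (future 0 \<omega>) \<partial>P q)"
  using h
proof (induction rule: borel_measurable_induct)
  case (cong f g)
  then have "(\<integral>\<^sup>+\<omega>. f \<omega> * c \<omega> \<partial>P i) = (\<integral>\<^sup>+\<omega>. g \<omega> * c \<omega> \<partial>P i)" for c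
    by (intro nn_integral_cong) (simp add: space_P i)
  then show ?case using cong(4) by (simp only: mult.assoc)
next
  case (set A)
  have "A \<inter> {\<omega>. J n \<omega> = q} = A \<inter> {\<omega> \<in> space (past n). J n \<omega> = q}"
    using sets.sets_into_space[OF set] by auto
  also have "\<dots> \<in> sets (past n)" using set by measurable
  finally have A: "A \<inter> {\<omega>. J n \<omega> = q} \<in> sets (past n)" .
  then have "A \<inter> {\<omega>. J n \<omega> = q} \<in> sets (P i)" using past_subset sets_P[OF i] by blast
  then show ?case
    using markov_shift_set[OF i q A _ F] by (simp add: indicator_inter_arith[symmetric])
next
  case (mult u c)
  note sets_P[OF i, measurable_cong]
  have [measurable]: "u \<in> borel_measurable \<Omega>"
    using mult(2) measurable_from_subalg[OF subalgebra_past] by blast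
  show ?case using mult(4)
    by (simp add: mult.assoc nn_integral_cmult)
next
  case (add u v)
  note sets_P[OF i, measurable_cong]
  have [measurable]: "u \<in> borel_measurable \<Omega>" "v \<in> borel_measurable \<Omega>"
    by (rule measurable_from_subalg[OF subalgebra_past], rule add)+
  show ?case using add
    by (simp add: distrib_right nn_integral_add)
next
  case (seq U)
  note sets_P[OF i, measurable_cong]
  have [measurable]: "U l \<in> borel_measurable \<Omega>" for l
    using seq measurable_from_subalg[OF subalgebra_past] by blast
  have "incseq (\<lambda>l \<omega>. U l \<omega> * c \<omega>)" for c :: "'a \<Rightarrow> ennreal"
    using seq(3) by (auto simp: incseq_def le_fun_def intro!: mult_right_mono)
  then have "(\<integral>\<^sup>+\<omega>. (SUP l. U l) \<omega> * c \<omega> \<partial>P i) = (SUP l. \<integral>\<^sup>+\<omega>. U l \<omega> * c \<omega> \<partial>P i)"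
    if [measurable]: "c \<in> borel_measurable \<Omega>" for c
    using that
    by (subst nn_integral_monotone_convergence_SUP[symmetric])
      (auto simp: SUP_mult_right_ennreal image_image)
  then show ?case using seq
    by (simp add: mult.assoc SUP_mult_right_ennreal)
qed

lemma avoid_past:
  assumes "n \<le> n'"
  shows "{\<omega> \<in> space \<Omega>. \<forall>l\<in>{..<n}. J (Suc l) \<omega> \<notin> S} \<in> sets (past n')"
proof -
  have "{\<omega> \<in> space (past n'). J (Suc l) \<omega> \<notin> S} \<in> sets (past n')" if "l < n" for l
    using measurable_sets[OF measurable_past_J[of "Suc l" n'], of "- S"] that assms
    by (simp add: vimage_def Int_def conj_commute)
  then have "{\<omega> \<in> space (past n'). \<forall>l\<in>{..<n}. J (Suc l) \<omega> \<notin> S} \<in> sets (past n')"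
    by (intro sets.sets_Collect_finite_All) auto
  then show ?thesis by simp
qed

lemma markov_past:
  assumes i: "i \<le> m" and A: "A \<in> sets (past n)"
    and F [measurable]: "F \<in> borel_measurable path_space"
  shows "(\<integral>\<^sup>+\<omega>. indicator A \<omega> * F (future n \<omega>) \<partial>P i)
    = (\<Sum>q\<le>m. emeasure (P i) (A \<inter> {\<omega> \<in> space \<Omega>. J n \<omega> = q}) * (\<integral>\<^sup>+\<omega>. F (future 0 \<omega>) \<partial>P q))"
proof -
  note sets_P[OF i, measurable_cong]
  have sets: "A \<inter> {\<omega> \<in> space \<Omega>. J n \<omega> = q} \<in> sets (past n)" for q
    using measurable_sets[OF measurable_past_J[of n n], of "{q}"]
    by (intro sets.Int A) (simp add: vimage_def Int_def conj_commute)
  then have [measurable]: "A \<inter> {\<omega> \<in> space \<Omega>. J n \<omega> = q} \<in> sets \<Omega>" for q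
    by (rule subsetD[OF past_subset])
  have "(\<integral>\<^sup>+\<omega>. indicator A \<omega> * F (future n \<omega>) \<partial>P i)
    = (\<integral>\<^sup>+\<omega>. (\<Sum>q\<le>m. indicator (A \<inter> {\<omega> \<in> space \<Omega>. J n \<omega> = q}) \<omega> * F (future n \<omega>)) \<partial>P i)"
  proof (rule nn_integral_cong)
    fix \<omega> assume "\<omega> \<in> space (P i)"
    then have \<omega>: "\<omega> \<in> space \<Omega>" by (simp add: space_P i)
    have "(\<Sum>q\<le>m. indicator (A \<inter> {\<omega> \<in> space \<Omega>. J n \<omega> = q}) \<omega> * F (future n \<omega>))
        = (\<Sum>q\<le>m. if q = J n \<omega> then indicator A \<omega> * F (future n \<omega>) else 0)"
      using \<omega> by (intro sum.cong) (auto simp: indicator_def)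
    then show "indicator A \<omega> * F (future n \<omega>)
        = (\<Sum>q\<le>m. indicator (A \<inter> {\<omega> \<in> space \<Omega>. J n \<omega> = q}) \<omega> * F (future n \<omega>))"
      using J_le[OF \<omega>] by simp
  qed
  also have "\<dots> = (\<Sum>q\<le>m. \<integral>\<^sup>+\<omega>. indicator (A \<inter> {\<omega> \<in> space \<Omega>. J n \<omega> = q}) \<omega> * F (future n \<omega>) \<partial>P i)"
    by (rule nn_integral_sum) measurable
  also have "\<dots> = (\<Sum>q\<le>m. emeasure (P i) (A \<inter> {\<omega> \<in> space \<Omega>. J n \<omega> = q}) * (\<integral>\<^sup>+\<omega>. F (future 0 \<omega>) \<partial>P q))"
    using sets by (intro sum.cong refl markov_shift_set i F) auto
  finally show ?thesis .
qed

subsection \<open>Recurrence\<close>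

text \<open>Maximum principle. Let p maximise the probability of never visiting 0, with maximum c.
  From p, state 0 is occupied at some time n \<ge> 1 with positive probability, so avoiding 0 up to
  n has probability a < 1. The Markov property at n yields c \<le> a * c, whence c = 0.\<close>

lemma never_zero_null:
  assumes A: "communicating m P J" and "i \<le> m"
  shows "(\<integral>\<^sup>+\<omega>. indicator {z \<in> space path_space. \<forall>n. fst (z n) \<noteq> 0} (future 0 \<omega>) \<partial>P i) = 0"
proof -
  let ?F = "indicator {z \<in> space path_space. \<forall>n. fst (z n) \<noteq> 0} :: _ \<Rightarrow> ennreal"
  have [measurable]: "?F \<in> borel_measurable path_space" by measurable
  define v where "v q = (\<integral>\<^sup>+\<omega>. ?F (future 0 \<omega>) \<partial>P q)" for q
  define c where "c = Max (v ` {..m})"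
  have le_c: "v q \<le> c" if "q \<le> m" for q
    unfolding c_def using that by (intro Max_ge) auto
  have "c \<in> v ` {..m}" unfolding c_def by (intro Max_in) auto
  then obtain p where p: "p \<le> m" "v p = c" by auto
  interpret prob_space "P p" using p by (intro prob_space_P)
  note sets_P[OF p(1), measurable_cong]
  obtain n where n: "n \<ge> 1" "0 < measure (P p) {\<omega> \<in> space (P p). J n \<omega> = 0}"
    using bspec[OF bspec[OF A[unfolded communicating_def], of p], of 0] p(1) by auto
  let ?A = "{\<omega> \<in> space \<Omega>. \<forall>l<n. J (Suc l) \<omega> \<noteq> 0}"
  have A_sets: "?A \<in> sets (past n)" using avoid_past[of n n "{0}"] by (simp only: Ball_def lessThan_iff singleton_iff order_refl)
  then have [measurable]: "?A \<in> sets \<Omega>" by (rule subsetD[OF past_subset])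
  have "c = (\<integral>\<^sup>+\<omega>. ?F (future 0 \<omega>) \<partial>P p)" using p(2) by (simp add: v_def)
  also have "\<dots> \<le> (\<integral>\<^sup>+\<omega>. indicator ?A \<omega> * ?F (future n \<omega>) \<partial>P p)"
  proof (rule nn_integral_mono)
    fix \<omega> assume "\<omega> \<in> space (P p)"
    then have \<omega>: "\<omega> \<in> space \<Omega>" by (simp add: space_P p)
    have space: "future l \<omega> \<in> space path_space" for l
      using measurable_space[OF measurable_future \<omega>] .
    show "?F (future 0 \<omega>) \<le> indicator ?A \<omega> * ?F (future n \<omega>)"
    proof (cases "\<forall>l. J (Suc l) \<omega> \<noteq> 0")
      case True
      then show ?thesis using \<omega> space by (simp add: future_def)
    next
      case False
      then show ?thesis by (simp add: future_def)
    qed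
  qed
  also have "\<dots> = (\<Sum>q\<le>m. emeasure (P p) (?A \<inter> {\<omega> \<in> space \<Omega>. J n \<omega> = q}) * v q)"
    unfolding v_def by (rule markov_past[OF p(1) A_sets]) measurable
  also have "\<dots> \<le> (\<Sum>q\<le>m. emeasure (P p) (?A \<inter> {\<omega> \<in> space \<Omega>. J n \<omega> = q}) * c)"
    by (intro sum_mono mult_left_mono le_c) auto
  also have "\<dots> = emeasure (P p) ?A * c"
    by (subst emeasure_split_J[OF p(1), of ?A n]) (simp_all add: sum_distrib_right)
  finally have c_le: "c \<le> emeasure (P p) ?A * c" .
  \<comment> \<open>In \<open>ennreal\<close> the inequality \<open>c_le\<close> alone does not
    exclude \<infinity> in general; the bound by 1 permits the passage to real numbers.\<close>
  have "c \<le> (\<integral>\<^sup>+\<omega>. 1 \<partial>P p)"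
    unfolding p(2)[symmetric] v_def by (intro nn_integral_mono) (auto simp: indicator_def)
  then have "c < \<top>" by (simp add: emeasure_space_1 le_less_trans[of _ 1])
  then obtain c' where c': "c = ennreal c'" "0 \<le> c'" by (cases c) auto
  have "measure (P p) ?A \<le> measure (P p) (space (P p) - {\<omega> \<in> space (P p). J n \<omega> = 0})"
    using n(1) by (intro finite_measure_mono) (auto simp: space_P p dest: spec[of _ "n - 1"])
  also have "\<dots> < 1" using n(2) by (subst prob_compl) auto
  finally have "measure (P p) ?A < 1" .
  moreover have "ennreal c' \<le> ennreal (measure (P p) ?A * c')"
    using c_le unfolding c'(1) emeasure_eq_measure by (subst ennreal_mult') auto
  then have "c' \<le> measure (P p) ?A * c'"
    by (subst (asm) ennreal_le_iff) (use c'(2) in \<open>auto intro: mult_nonneg_nonneg\<close>)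
  ultimately have "c' = 0"
    using c'(2) mult_right_le_one_le[of c'] by (cases "c' = 0") (auto simp: mult_le_cancel_right2)
  then show ?thesis using le_c[OF assms(2)] c' by (simp add: v_def)
qed

text \<open>Never visiting 0 after time n is null for each n: by the Markov property its probability
  is a finite combination of the null probabilities above.\<close>

lemma AE_infinitely_often_zero:
  assumes A: "communicating m P J" and i: "i \<le> m"
  shows "AE \<omega> in P i. \<forall>n. \<exists>r>n. J r \<omega> = 0"
  unfolding AE_all_countable
proof
  fix n
  let ?F = "indicator {z \<in> space path_space. \<forall>n. fst (z n) \<noteq> 0} :: _ \<Rightarrow> ennreal"
  note sets_P[OF i, measurable_cong]
  have "(\<integral>\<^sup>+\<omega>. indicator (space \<Omega>) \<omega> * ?F (future n \<omega>) \<partial>P i) = 0"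
    using sets.top[of "past n"] never_zero_null[OF A]
    by (subst markov_past[OF i]) auto
  then have "AE \<omega> in P i. indicator (space \<Omega>) \<omega> * ?F (future n \<omega>) = 0"
    by (subst (asm) nn_integral_0_iff_AE) auto
  with AE_space show "AE \<omega> in P i. \<exists>r>n. J r \<omega> = 0"
  proof eventually_elim
    case (elim \<omega>)
    then have "future n \<omega> \<notin> {z \<in> space path_space. \<forall>n. fst (z n) \<noteq> 0}"
      by (auto simp: space_P i indicator_def split: if_splits)
    then obtain l where "J (Suc (n + l)) \<omega> = 0"
      using measurable_space[OF measurable_future, of \<omega> n] elim(1) by (auto simp: future_def space_P i)
    then show ?case by (intro exI[of _ "Suc (n + l)"]) auto
  qed
qed

lemma AE_X_pos:
  assumes B: "\<forall>q\<in>{0..m}. \<forall>j\<in>{0..m}. Q q j 0 = 0" and i: "i \<le> m"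
  shows "AE \<omega> in P i. \<forall>n. 0 < X (Suc n) \<omega>"
  unfolding AE_all_countable
proof
  fix n
  interpret prob_space "P i" using i by (rule prob_space_P)
  note sets_P[OF i, measurable_cong]
  have "AE \<omega> in P i. \<not> (J n \<omega> = q \<and> J (Suc n) \<omega> = j \<and> X (Suc n) \<omega> \<le> 0)" if "q \<le> m" "j \<le> m" for q j
  proof -
    let ?A = "{\<omega> \<in> space \<Omega>. J n \<omega> = q}" and ?B = "{\<omega> \<in> space \<Omega>. J (Suc n) \<omega> = j \<and> X (Suc n) \<omega> \<le> 0}"
    have "?A \<in> sets (past n)"
      using measurable_sets[OF measurable_past_J[of n n], of "{q}"]
      by (simp add: vimage_def Int_def conj_commute)
    then have "measure (P i) (?A \<inter> ?B) = 0"
      using markov_step_atMost[OF i that, of 0 ?A n] B that by auto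
    then have "?A \<inter> ?B \<in> null_sets (P i)"
      by (simp add: null_sets_def emeasure_eq_measure)
    from AE_not_in[OF this] AE_space show ?thesis
      by eventually_elim (auto simp: space_P i)
  qed
  then have "AE \<omega> in P i. \<forall>q\<in>{..m}. \<forall>j\<in>{..m}. \<not> (J n \<omega> = q \<and> J (Suc n) \<omega> = j \<and> X (Suc n) \<omega> \<le> 0)"
    by (intro AE_finite_allI) auto
  with AE_space show "AE \<omega> in P i. 0 < X (Suc n) \<omega>"
    by eventually_elim (use i in \<open>auto simp: space_P J_le not_le\<close>)
qed

subsection \<open>First passages\<close>

lemma future_shift: "future (n + l) \<omega> = (\<lambda>s. future n \<omega> (l + s))"
  by (simp add: future_def add.assoc fun_eq_iff)

lemma future_Suc_hit:
  "future (Suc (hit S (future 0 \<omega>))) \<omega> = (\<lambda>s. future 0 \<omega> (Suc (hit S (future 0 \<omega>)) + s))"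
  using future_shift[of 0 "Suc (hit S (future 0 \<omega>))" \<omega>] by simp

lemma elapsed_nonneg: "\<omega> \<in> space \<Omega> \<Longrightarrow> 0 \<le> elapsed S (future n \<omega>)"
  unfolding elapsed_def future_def by (intro sum_nonneg) (simp add: X_nonneg)

lemma measurable_future_hit [measurable]:
  "(\<lambda>\<omega>. future (Suc (hit S (future 0 \<omega>))) \<omega>) \<in> \<Omega> \<rightarrow>\<^sub>M path_space"
  by (rule measurable_compose_countable[where f = "\<lambda>n \<omega>. future (Suc n) \<omega>"]) measurable

text \<open>Decomposition by the value n of the hitting index: everything before the restart belongs
  to \<open>past (Suc n)\<close>, so the Markov property at the fixed time \<open>Suc n\<close>
  factorises each summand. No visit to S has to be assumed, since \<open>place S z = k\<close> with
  k \<in> S already certifies one.\<close>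

lemma strong_markov:
  assumes i: "i \<le> m" and k: "k \<le> m" "k \<in> S"
    and F [measurable]: "F \<in> borel_measurable path_space"
  shows "(\<integral>\<^sup>+\<omega>. ennreal (elapsed S (future 0 \<omega>)) ^ a * indicator {z. place S z = k} (future 0 \<omega>)
        * F (future (Suc (hit S (future 0 \<omega>))) \<omega>) \<partial>P i)
    = (\<integral>\<^sup>+\<omega>. ennreal (elapsed S (future 0 \<omega>)) ^ a * indicator {z. place S z = k} (future 0 \<omega>) \<partial>P i)
        * (\<integral>\<^sup>+\<omega>. F (future 0 \<omega>) \<partial>P k)"
proof -
  note sets_P[OF i, measurable_cong]
  \<comment> \<open>Together with \<open>J (Suc n) = k\<close>, the indicator in \<open>h n\<close>
    says that the first visit to S has index n and is at k.\<close>
  define h where "h n \<omega> = ennreal (\<Sum>l\<le>n. X (Suc l) \<omega>) ^ a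
    * indicator {\<omega>. \<forall>l\<in>{..<n}. J (Suc l) \<omega> \<notin> S} \<omega>" for n \<omega>
  have h_past: "h n \<in> borel_measurable (past (Suc n))" for n
  proof -
    have "(\<lambda>\<omega>. \<Sum>l\<le>n. X (Suc l) \<omega>) \<in> borel_measurable (past (Suc n))"
      by (intro borel_measurable_sum measurable_past_X) auto
    moreover have "{\<omega> \<in> space (past (Suc n)). \<forall>l\<in>{..<n}. J (Suc l) \<omega> \<notin> S} \<in> sets (past (Suc n))"
      using avoid_past[of n "Suc n"] by simp
    ultimately show ?thesis unfolding h_def by measurable
  qed
  have [measurable]: "h n \<in> borel_measurable \<Omega>" for n
    by (rule measurable_from_subalg[OF subalgebra_past h_past])
  have sum: "(\<Sum>n. h n \<omega> * indicator {\<omega>. J (Suc n) \<omega> = k} \<omega> * c n)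
      = ennreal (elapsed S (future 0 \<omega>)) ^ a * indicator {z. place S z = k} (future 0 \<omega>)
        * c (hit S (future 0 \<omega>))" for c :: "nat \<Rightarrow> ennreal" and \<omega>
  proof -
    let ?z = "future 0 \<omega>" and ?f = "\<lambda>n. h n \<omega> * indicator {\<omega>. J (Suc n) \<omega> = k} \<omega> * c n"
    have z: "fst (?z n) = J (Suc n) \<omega>" for n by (simp add: future_def)
    have "?f n = 0" if "n \<notin> {hit S ?z}" for n
    proof (rule ccontr)
      assume "?f n \<noteq> 0"
      then have "J (Suc n) \<omega> = k" "\<forall>l<n. J (Suc l) \<omega> \<notin> S"
        by (auto simp: h_def indicator_def split: if_splits)
      then have "hit S ?z = n" using k(2) by (intro hit_eqI) (auto simp: z)
      then show False using that by simp
    qed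
    then have "(\<Sum>n. ?f n) = ?f (hit S ?z)" by (subst suminf_finite[of "{hit S ?z}"]) auto
    also have "\<dots> = ennreal (elapsed S ?z) ^ a * indicator {z. place S z = k} ?z * c (hit S ?z)"
      using before_hit[of _ S ?z]
      by (auto simp: h_def elapsed_def place_def z indicator_def) (auto simp: future_def)
    finally show ?thesis .
  qed
  have "(\<integral>\<^sup>+\<omega>. ennreal (elapsed S (future 0 \<omega>)) ^ a * indicator {z. place S z = k} (future 0 \<omega>)
        * F (future (Suc (hit S (future 0 \<omega>))) \<omega>) \<partial>P i)
      = (\<integral>\<^sup>+\<omega>. (\<Sum>n. h n \<omega> * indicator {\<omega>. J (Suc n) \<omega> = k} \<omega> * F (future (Suc n) \<omega>)) \<partial>P i)"
    using sum[of _ "\<lambda>n. F (future (Suc n) _)"] by (intro nn_integral_cong) (simp add: sum)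
  also have "\<dots> = (\<Sum>n. \<integral>\<^sup>+\<omega>. h n \<omega> * indicator {\<omega>. J (Suc n) \<omega> = k} \<omega> * F (future (Suc n) \<omega>) \<partial>P i)"
    by (rule nn_integral_suminf) measurable
  also have "\<dots> = (\<Sum>n. (\<integral>\<^sup>+\<omega>. h n \<omega> * indicator {\<omega>. J (Suc n) \<omega> = k} \<omega> \<partial>P i)
      * (\<integral>\<^sup>+\<omega>. F (future 0 \<omega>) \<partial>P k))"
    by (intro suminf_cong markov_shift i k h_past F)
  \<comment> \<open>The factor 1 gives the first series the shape of \<open>sum\<close> with a
    constant c, which reassembles the passage without its continuation.\<close>
  also have "\<dots> = (\<Sum>n. \<integral>\<^sup>+\<omega>. h n \<omega> * indicator {\<omega>. J (Suc n) \<omega> = k} \<omega> * 1 \<partial>P i)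
      * (\<integral>\<^sup>+\<omega>. F (future 0 \<omega>) \<partial>P k)"
    by (simp add: ennreal_suminf_multc)
  also have "(\<Sum>n. \<integral>\<^sup>+\<omega>. h n \<omega> * indicator {\<omega>. J (Suc n) \<omega> = k} \<omega> * 1 \<partial>P i)
      = (\<integral>\<^sup>+\<omega>. (\<Sum>n. h n \<omega> * indicator {\<omega>. J (Suc n) \<omega> = k} \<omega> * 1) \<partial>P i)"
    by (rule nn_integral_suminf[symmetric]) measurable
  finally show ?thesis unfolding sum[of _ "\<lambda>_. 1"] by simp
qed

end

subsection \<open>Moments of first passages\<close>

lemma ennreal_affine_fixpoint:
  fixes a p x :: ennreal
  assumes "x = a + p * x" "x < \<infinity>" "p < 1"
  shows "x = a / (1 - p)"
proof -
  obtain x' where x: "x = ennreal x'" "0 \<le> x'" using assms(2) by (cases x) auto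
  obtain p' where p: "p = ennreal p'" "0 \<le> p'" "p' < 1" using assms(3) by (cases p) auto
  have "a \<le> x" by (subst assms(1)) simp
  then obtain a' where a: "a = ennreal a'" "0 \<le> a'" using x by (cases a) (auto simp: top_unique)
  have "x' = a' + p' * x'"
    using assms(1) x p a by (simp add: ennreal_mult'[symmetric] ennreal_plus[symmetric] del: ennreal_plus)
  then have "x' = a' / (1 - p')" using p by (simp add: field_simps)
  moreover have "1 - p = ennreal (1 - p')" using p by (simp add: ennreal_minus flip: ennreal_1)
  ultimately show ?thesis using x p a by (simp add: divide_ennreal)
qed

text \<open>\<open>a / (1 - p)\<close> is a fixed point of the monotone map x \<mapsto> a + p * x,
  and iterates from 0 stay below it. The iterates are not presumed finite, so the bound can serve to
  prove finiteness.\<close>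

lemma ennreal_affine_iterates_le:
  fixes a p :: ennreal and x :: "nat \<Rightarrow> ennreal"
  assumes "x 0 = 0" "\<And>n. x (Suc n) \<le> a + p * x n" "p < 1"
  shows "x n \<le> a / (1 - p)"
proof (cases "a = \<top>")
  case True
  then show ?thesis using assms(3) by (simp add: ennreal_top_divide)
next
  case False
  then obtain a' where a: "a = ennreal a'" "0 \<le> a'" by (cases a) auto
  obtain p' where p: "p = ennreal p'" "0 \<le> p'" "p' < 1" using assms(3) by (cases p) auto
  have "1 - p = ennreal (1 - p')" using p by (simp add: ennreal_minus flip: ennreal_1)
  then have b: "a / (1 - p) = ennreal (a' / (1 - p'))" using a p by (simp add: divide_ennreal)
  have "a' + p' * (a' / (1 - p')) = a' / (1 - p')" using p by (simp add: field_simps)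
  then have fixpoint: "a + p * (a / (1 - p)) = a / (1 - p)"
    unfolding b using a p
    by (simp add: ennreal_mult'[symmetric] ennreal_plus[symmetric] del: ennreal_plus)
  show ?thesis
  proof (induction n)
    case (Suc n)
    have "x (Suc n) \<le> a + p * x n" by (rule assms)
    also have "\<dots> \<le> a + p * (a / (1 - p))" by (intro add_left_mono mult_left_mono Suc) simp
    finally show ?case by (simp only: fixpoint)
  qed (simp add: assms)
qed

text \<open>N limits the number of steps: N = 0 gives the value 0, and N = \<infinity> imposes no
  limit. For r = 0 this is the indicator of arrival at j within the limit.\<close>

definition reward :: "nat set \<Rightarrow> enat \<Rightarrow> nat \<Rightarrow> nat \<Rightarrow> (nat \<Rightarrow> nat \<times> real) \<Rightarrow> ennreal" where
  "reward S N r j z = ennreal (elapsed S z) ^ r * indicator {z. place S z = j \<and> enat (hit S z) < N} z"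

lemma measurable_reward [measurable]: "reward S N r j \<in> borel_measurable path_space"
  unfolding reward_def by measurable

context markov_renewal_process
begin

definition passage_moment :: "nat set \<Rightarrow> enat \<Rightarrow> nat \<Rightarrow> nat \<Rightarrow> nat \<Rightarrow> ennreal" where
  "passage_moment S N r i j = (\<integral>\<^sup>+\<omega>. reward S N r j (future 0 \<omega>) \<partial>P i)"

abbreviation (input) full_moment :: "nat set \<Rightarrow> nat \<Rightarrow> nat \<Rightarrow> nat \<Rightarrow> ennreal" where
  "full_moment S \<equiv> passage_moment S \<infinity>"

text \<open>The times of the two legs add, the binomial theorem splits the power of the sum, and
  \<open>strong_markov\<close> factorises each term. The reward of order 0 acts as the indicator of
  the arrival; multiplied by the l-th power of the second time it becomes the reward of order
  l.\<close>

lemma nn_integral_continued_reward: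
  assumes i: "i \<le> m" and k: "k \<le> m" "k \<in> S"
  shows "(\<integral>\<^sup>+\<omega>. indicator {z. place S z = k} (future 0 \<omega>)
        * ((ennreal (elapsed S (future 0 \<omega>)) + ennreal (elapsed S' (future (Suc (hit S (future 0 \<omega>))) \<omega>))) ^ r
          * reward S' N 0 j (future (Suc (hit S (future 0 \<omega>))) \<omega>)) \<partial>P i)
    = (\<Sum>l\<le>r. of_nat (r choose l) * full_moment S (r - l) i k * passage_moment S' N l k j)"
    (is "(\<integral>\<^sup>+\<omega>. ?L \<omega> \<partial>P i) = _")
proof -
  note sets_P[OF i, measurable_cong]
  have "(\<integral>\<^sup>+\<omega>. ?L \<omega> \<partial>P i) = (\<integral>\<^sup>+\<omega>. (\<Sum>l\<le>r. of_nat (r choose l) *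
      (ennreal (elapsed S (future 0 \<omega>)) ^ (r - l) * indicator {z. place S z = k} (future 0 \<omega>)
        * reward S' N l j (future (Suc (hit S (future 0 \<omega>))) \<omega>))) \<partial>P i)"
    by (intro nn_integral_cong)
      (simp add: add.commute[of "ennreal (elapsed S _)"] binomial_ring reward_def
        sum_distrib_left sum_distrib_right mult_ac)
  also have "\<dots> = (\<Sum>l\<le>r. of_nat (r choose l) *
      (\<integral>\<^sup>+\<omega>. ennreal (elapsed S (future 0 \<omega>)) ^ (r - l) * indicator {z. place S z = k} (future 0 \<omega>)
        * reward S' N l j (future (Suc (hit S (future 0 \<omega>))) \<omega>) \<partial>P i))"
    by (subst nn_integral_sum, measurable, intro sum.cong refl nn_integral_cmult) measurable
  also have "\<dots> = (\<Sum>l\<le>r. of_nat (r choose l) * full_moment S (r - l) i k * passage_moment S' N l k j)"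
    by (subst strong_markov[OF i k]) (simp_all add: passage_moment_def reward_def mult.assoc)
  finally show ?thesis .
qed

text \<open>Monotone convergence: bounds on truncated moments that are uniform in the truncation
  pass to the full moments.\<close>

lemma full_moment_SUP:
  assumes i: "i \<le> m"
  shows "full_moment S' r i j = (SUP n. passage_moment S' (enat n) r i j)"
proof -
  note sets_P[OF i, measurable_cong]
  have "(\<lambda>n. reward S' (enat n) r j z) \<longlonglongrightarrow> reward S' \<infinity> r j z" for z
    by (rule tendsto_eventually, rule eventually_sequentiallyI[of "Suc (hit S' z)"])
      (simp add: reward_def indicator_def)
  moreover have inc: "incseq (\<lambda>n. reward S' (enat n) r j z)" for z
    by (auto simp: incseq_def reward_def indicator_def intro: less_le_trans)
  ultimately have "reward S' \<infinity> r j z = (SUP n. reward S' (enat n) r j z)" for z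
    using LIMSEQ_SUP[OF inc] LIMSEQ_unique by blast
  then show ?thesis
    unfolding passage_moment_def using inc
    by (subst nn_integral_monotone_convergence_SUP[symmetric])
      (auto simp: incseq_def le_fun_def)
qed

lemma future_hits:
  assumes "\<forall>n. \<exists>r>n. J r \<omega> = 0" "0 \<in> S'"
  shows "\<exists>s. fst (future n \<omega> s) \<in> S'"
proof -
  obtain r where "r > n" "J r \<omega> = 0" using assms(1) by blast
  then show ?thesis using assms(2) by (intro exI[of _ "r - Suc n"]) (simp add: future_def)
qed

section \<open>Excluding one state\<close>

context
  fixes S :: "nat set" and k :: nat
  assumes comm: "communicating m P J"
    and zero: "0 \<in> S" and k: "k \<in> S" "k \<le> m" "k \<noteq> 0"
begin

text \<open>\<open>C\<close> is the contribution of passages whose first visit to S is at k. Their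
  first leg costs at least one step, so a limit \<open>eSuc N\<close> on the whole leaves at most N
  for the continuation; the first leg itself is not truncated on the right, hence only \<le>. For j
  \<noteq> k exactly one of the two summands can be nonzero.\<close>

lemma reward_remove:
  fixes r j :: nat
  assumes \<omega>: "\<omega> \<in> space \<Omega>" "\<forall>n. \<exists>r>n. J r \<omega> = 0" and j: "j \<noteq> k"
  defines "z \<equiv> future 0 \<omega>" and "z' \<equiv> future (Suc (hit S (future 0 \<omega>))) \<omega>"
  defines "C \<equiv> \<lambda>N. indicator {z. place S z = k} z
    * ((ennreal (elapsed S z) + ennreal (elapsed (S - {k}) z')) ^ r * reward (S - {k}) N 0 j z')"
  shows "reward (S - {k}) (eSuc N) r j z \<le> reward S \<infinity> r j z + C N"
    and "reward (S - {k}) \<infinity> r j z = reward S \<infinity> r j z + C \<infinity>"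
proof -
  have z': "z' = (\<lambda>n. z (Suc (hit S z) + n))" unfolding z_def z'_def by (rule future_Suc_hit)
  have "\<exists>n. fst (z n) \<in> S" unfolding z_def using \<omega>(2) zero by (rule future_hits)
  note stay = hit_remove[OF this, of k]
  have "\<exists>n. fst (z' n) \<in> S - {k}"
    unfolding z'_def using \<omega>(2) by (rule future_hits) (use zero k in auto)
  then have ex: "\<exists>n. fst (z (Suc (hit S z) + n)) \<in> S - {k}" by (simp add: z')
  note move = hit_remove_shift[OF _ ex, folded z'] place_remove_shift[OF _ ex, folded z']
    elapsed_remove_shift[OF _ ex, folded z']
  have pos: "0 \<le> elapsed S z" "0 \<le> elapsed (S - {k}) z'"
    unfolding z_def z'_def using elapsed_nonneg[OF \<omega>(1)] by auto
  have bound: "enat n' < N" if "enat (Suc (n + n')) < eSuc N" for n n'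
    using that by (cases N) (auto simp: eSuc_enat)
  show "reward (S - {k}) (eSuc N) r j z \<le> reward S \<infinity> r j z + C N"
  proof (cases "place S z = k")
    case True
    then show ?thesis using pos bound
      by (auto simp: reward_def C_def move ennreal_plus indicator_def)
  next
    case False
    then show ?thesis using stay[OF False]
      by (auto simp: reward_def C_def place_def elapsed_def indicator_def)
  qed
  show "reward (S - {k}) \<infinity> r j z = reward S \<infinity> r j z + C \<infinity>"
  proof (cases "place S z = k")
    case True
    then show ?thesis using pos j
      by (auto simp: reward_def C_def move ennreal_plus indicator_def)
  next
    case False
    then show ?thesis using stay[OF False]
      by (auto simp: reward_def C_def place_def elapsed_def indicator_def)
  qed
qed

text \<open>The limit drops from \<open>eSuc N\<close> to N, so for i = k this is a recursive
  inequality in the number of steps.\<close>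

lemma passage_moment_remove_le:
  assumes i: "i \<le> m" and j: "j \<noteq> k"
  shows "passage_moment (S - {k}) (eSuc N) r i j \<le> full_moment S r i j
    + (\<Sum>l\<le>r. of_nat (r choose l) * full_moment S (r - l) i k * passage_moment (S - {k}) N l k j)"
proof -
  note sets_P[OF i, measurable_cong]
  have good: "AE \<omega> in P i. \<omega> \<in> space \<Omega> \<and> (\<forall>n. \<exists>r>n. J r \<omega> = 0)"
    using AE_infinitely_often_zero[OF comm i] AE_space by eventually_elim (simp add: space_P i)
  show ?thesis
    unfolding nn_integral_continued_reward[OF i k(2,1), symmetric]
    unfolding passage_moment_def
  proof (subst nn_integral_add[symmetric], measurable, rule nn_integral_mono_AE, use good in eventually_elim)
    case (elim \<omega>)
    then show ?case using reward_remove(1)[OF _ _ j] by simp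
  qed
qed

lemma full_moment_remove:
  assumes i: "i \<le> m" and j: "j \<noteq> k"
  shows "full_moment (S - {k}) r i j = full_moment S r i j
    + (\<Sum>l\<le>r. of_nat (r choose l) * full_moment S (r - l) i k * full_moment (S - {k}) l k j)"
proof -
  note sets_P[OF i, measurable_cong]
  have good: "AE \<omega> in P i. \<omega> \<in> space \<Omega> \<and> (\<forall>n. \<exists>r>n. J r \<omega> = 0)"
    using AE_infinitely_often_zero[OF comm i] AE_space by eventually_elim (simp add: space_P i)
  show ?thesis
    unfolding nn_integral_continued_reward[OF i k(2,1), symmetric]
    unfolding passage_moment_def
  proof (subst nn_integral_add[symmetric], measurable, rule nn_integral_cong_AE, use good in eventually_elim)
    case (elim \<omega>)
    then show ?case using reward_remove(2)[OF _ _ j] by simp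
  qed
qed

text \<open>If the process returned to \<open>k\<close> almost surely before hitting \<open>S - {k}\<close>, then
  \<open>E\<^sub>k[2\<^bsup>-h\<^esup>] \<le> E\<^sub>k[2\<^bsup>-h\<^esup>] / 2\<close> for the hitting index \<open>h\<close> of 0, as each return costs at
  least one step.\<close>

lemma return_prob_less_1: "full_moment S 0 k k < 1"
proof -
  interpret prob_space "P k" using k by (intro prob_space_P)
  note sets_P[OF k(2), measurable_cong]
  define F where "F z = ennreal ((1 / 2) ^ hit {0} z)" for z :: "nat \<Rightarrow> nat \<times> real"
  have [measurable]: "F \<in> borel_measurable path_space" unfolding F_def by measurable
  have [measurable]: "{\<omega> \<in> space \<Omega>. place S (future 0 \<omega>) = k} \<in> sets \<Omega>" by measurable
  have p: "full_moment S 0 k k = emeasure (P k) {\<omega> \<in> space \<Omega>. place S (future 0 \<omega>) = k}"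
    unfolding passage_moment_def reward_def
    by (subst nn_integral_indicator[symmetric], simp, intro nn_integral_cong)
      (auto simp: indicator_def space_P k)
  then have le: "full_moment S 0 k k \<le> 1" by (simp add: emeasure_le_1)
  have "full_moment S 0 k k \<noteq> 1"
  proof
    assume one: "full_moment S 0 k k = 1"
    then have "AE \<omega> in P k. place S (future 0 \<omega>) = k"
      using AE_prob_1[of "{\<omega> \<in> space \<Omega>. place S (future 0 \<omega>) = k}"] p
      by (simp add: emeasure_eq_measure)
    \<comment> \<open>The power with exponent 0 equals 1; it brings the integrand into the form of
      \<open>strong_markov\<close> with a = 0.\<close>
    then have "AE \<omega> in P k. F (future 0 \<omega>) \<le> ennreal (1 / 2) * (ennreal (elapsed S (future 0 \<omega>)) ^ 0
        * indicator {z. place S z = k} (future 0 \<omega>) * F (future (Suc (hit S (future 0 \<omega>))) \<omega>))"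
      using AE_infinitely_often_zero[OF comm k(2)]
    proof eventually_elim
      case (elim \<omega>)
      let ?h = "hit S (future 0 \<omega>)"
      have "\<exists>s. fst (future (Suc ?h) \<omega> s) \<in> {0}" using elim(2) by (rule future_hits) simp
      \<comment> \<open>The first leg misses 0: before \<open>?h\<close> no state lies in S, which
        contains 0, and at \<open>?h\<close> the state is k \<noteq> 0.\<close>
      moreover have "fst (future 0 \<omega> s) \<noteq> 0" if "s < Suc ?h" for s
        using that before_hit[of s S "future 0 \<omega>"] elim(1) zero k(3)
        by (cases "s = ?h") (auto simp: place_def intro!: gr0I)
      ultimately have "hit {0} (future 0 \<omega>) = Suc ?h + hit {0} (future (Suc ?h) \<omega>)"
        unfolding future_Suc_hit by (intro hit_shift) auto
      then have "F (future 0 \<omega>) \<le> ennreal (1 / 2 * (1 / 2) ^ hit {0} (future (Suc ?h) \<omega>))"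
        unfolding F_def by (intro ennreal_leI) (simp add: power_add power_le_one mult_left_le_one_le)
      also have "\<dots> = ennreal (1 / 2) * F (future (Suc ?h) \<omega>)"
        unfolding F_def by (rule ennreal_mult') simp
      finally show ?case using elim(1) by simp
    qed
    then have "(\<integral>\<^sup>+\<omega>. F (future 0 \<omega>) \<partial>P k) \<le> ennreal (1 / 2) * (\<integral>\<^sup>+\<omega>. ennreal (elapsed S (future 0 \<omega>)) ^ 0
        * indicator {z. place S z = k} (future 0 \<omega>) * F (future (Suc (hit S (future 0 \<omega>))) \<omega>) \<partial>P k)"
      by (subst nn_integral_cmult[symmetric]) (auto intro!: nn_integral_mono_AE)
    also have "\<dots> = ennreal (1 / 2) * (\<integral>\<^sup>+\<omega>. F (future 0 \<omega>) \<partial>P k)"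
      using one unfolding passage_moment_def reward_def by (subst strong_markov) (simp_all add: k)
    finally have le_half: "(\<integral>\<^sup>+\<omega>. F (future 0 \<omega>) \<partial>P k) \<le> ennreal (1 / 2) * (\<integral>\<^sup>+\<omega>. F (future 0 \<omega>) \<partial>P k)" .
    have "(\<integral>\<^sup>+\<omega>. F (future 0 \<omega>) \<partial>P k) \<le> (\<integral>\<^sup>+\<omega>. 1 \<partial>P k)"
      unfolding F_def by (intro nn_integral_mono) (simp add: power_le_one)
    then have "(\<integral>\<^sup>+\<omega>. F (future 0 \<omega>) \<partial>P k) < \<top>"
      by (simp add: emeasure_space_1 le_less_trans[of _ 1])
    then obtain c where c: "(\<integral>\<^sup>+\<omega>. F (future 0 \<omega>) \<partial>P k) = ennreal c" "0 \<le> c"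
      by (cases "\<integral>\<^sup>+\<omega>. F (future 0 \<omega>) \<partial>P k") auto
    have "ennreal c \<le> ennreal (1 / 2 * c)"
      using le_half unfolding c(1) by (subst ennreal_mult') auto
    then have "c \<le> 1 / 2 * c" using c(2) by (subst (asm) ennreal_le_iff) auto
    then have "(\<integral>\<^sup>+\<omega>. F (future 0 \<omega>) \<partial>P k) = 0" using c by simp
    \<comment> \<open>This is absurd because F is strictly positive and \<open>P k\<close> has mass
      1.\<close>
    then have "AE \<omega> in P k. F (future 0 \<omega>) = 0"
      by (subst (asm) nn_integral_0_iff_AE) auto
    then show False by (simp add: F_def)
  qed
  with le show ?thesis by simp
qed

text \<open>For passages from k, strong induction on the order makes the constant a finite. The
  truncated moments are then bounded by \<open>a / (1 - ?p)\<close> uniformly in n, and so is their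
  supremum. Other start states follow from the exact recursion, whose terms are now all
  finite.\<close>

lemma full_moment_remove_finite:
  assumes fin: "\<And>l i j. l \<le> r \<Longrightarrow> i \<le> m \<Longrightarrow> j \<in> S \<Longrightarrow> full_moment S l i j < \<infinity>"
    and i: "i \<le> m" and j: "j \<in> S - {k}"
  shows "full_moment (S - {k}) r i j < \<infinity>"
proof -
  have "full_moment (S - {k}) l k j < \<infinity>" if "l \<le> r" for l
    using that
  proof (induction l rule: less_induct)
    case (less l)
    let ?p = "full_moment S 0 k k"
    define a where "a = full_moment S l k j
      + (\<Sum>s<l. of_nat (l choose s) * full_moment S (l - s) k k * full_moment (S - {k}) s k j)"
    have "a < \<infinity>"
      unfolding a_def using less fin k j
      by (auto simp: ennreal_mult_less_top of_nat_less_top)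
    have "passage_moment (S - {k}) (enat n) l k j \<le> a / (1 - ?p)" for n
    proof (rule ennreal_affine_iterates_le[OF _ _ return_prob_less_1,
          where x = "\<lambda>n. passage_moment (S - {k}) (enat n) l k j"])
      show "passage_moment (S - {k}) (enat 0) l k j = 0"
        by (simp add: passage_moment_def reward_def flip: zero_enat_def)
      fix n
      \<comment> \<open>Lower orders are replaced by their full moments, so that a does not depend
        on n; only the term of order l keeps its truncation.\<close>
      have mono: "passage_moment (S - {k}) (enat n) s k j \<le> full_moment (S - {k}) s k j" for s
        unfolding full_moment_SUP[OF k(2)] by (rule SUP_upper) simp
      have "passage_moment (S - {k}) (enat (Suc n)) l k j \<le> full_moment S l k j
        + (\<Sum>s\<le>l. of_nat (l choose s) * full_moment S (l - s) k k * passage_moment (S - {k}) (enat n) s k j)"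
        using passage_moment_remove_le[of k j "enat n" l] k j by (simp add: eSuc_enat)
      also have "\<dots> \<le> a + ?p * passage_moment (S - {k}) (enat n) l k j"
        unfolding a_def lessThan_Suc_atMost[symmetric] sum.lessThan_Suc add.assoc[symmetric]
        by (intro add_mono sum_mono mult_left_mono mono) auto
      finally show "passage_moment (S - {k}) (enat (Suc n)) l k j
        \<le> a + ?p * passage_moment (S - {k}) (enat n) l k j" .
    qed
    then have "full_moment (S - {k}) l k j \<le> a / (1 - ?p)"
      unfolding full_moment_SUP[OF k(2)] by (rule SUP_least)
    also have "\<dots> < \<infinity>"
      using \<open>a < \<infinity>\<close> return_prob_less_1
      by (simp add: ennreal_divide_eq_top_iff less_top[symmetric] diff_eq_0_iff_ennreal not_le)
    finally show ?case .
  qed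
  then show ?thesis
    using fin i j k
    by (subst full_moment_remove) (auto simp: ennreal_mult_eq_top_iff less_top[symmetric])
qed

text \<open>The term l = r of the recursion contains the unknown multiplied by the return
  probability; the linear equation is solved for it.\<close>

lemma full_moment_remove_self:
  assumes fin: "full_moment (S - {k}) r k j < \<infinity>" and j: "j \<noteq> k"
  shows "full_moment (S - {k}) r k j = 1 / (1 - full_moment S 0 k k) * (full_moment S r k j
    + (\<Sum>l<r. of_nat (r choose l) * full_moment S (r - l) k k * full_moment (S - {k}) l k j))"
proof -
  have "full_moment (S - {k}) r k j = (full_moment S r k j
    + (\<Sum>l<r. of_nat (r choose l) * full_moment S (r - l) k k * full_moment (S - {k}) l k j))
    + full_moment S 0 k k * full_moment (S - {k}) r k j"
    using full_moment_remove[OF k(2) j, of r]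
    unfolding lessThan_Suc_atMost[symmetric] sum.lessThan_Suc by (simp add: add.assoc)
  from ennreal_affine_fixpoint[OF this fin return_prob_less_1] show ?thesis
    by (simp add: divide_ennreal_def mult.commute)
qed

end

end

subsection \<open>The recurrent algorithm\<close>

lemma measurable_visit:
  fixes j :: "'a \<Rightarrow> nat \<Rightarrow> nat"
  assumes [measurable]: "\<And>l. (\<lambda>\<omega>. j \<omega> l) \<in> M \<rightarrow>\<^sub>M count_space UNIV"
  shows "(\<lambda>\<omega>. visit S (j \<omega>) n) \<in> M \<rightarrow>\<^sub>M count_space UNIV"
proof (induction n)
  case (Suc n)
  note Suc [measurable]
  show ?case unfolding visit.simps by measurable
qed simp

lemma measurable_exclude:
  assumes z [measurable]: "\<And>l. (\<lambda>\<omega>. z \<omega> l) \<in> M \<rightarrow>\<^sub>M count_space UNIV \<Otimes>\<^sub>M borel"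
  shows "(\<lambda>\<omega>. exclude Y k (z \<omega>) n) \<in> M \<rightarrow>\<^sub>M count_space UNIV \<Otimes>\<^sub>M borel"
proof -
  define V where "V n \<omega> = visit (Y - {k}) (\<lambda>l. fst (z \<omega> l)) n" for n \<omega>
  have V [measurable]: "V n \<in> M \<rightarrow>\<^sub>M count_space UNIV" for n
    unfolding V_def by (rule measurable_visit) measurable
  have [measurable]: "(\<lambda>\<omega>. z \<omega> (V n \<omega>)) \<in> M \<rightarrow>\<^sub>M count_space UNIV \<Otimes>\<^sub>M borel"
    by (rule measurable_compose_countable[OF z V])
  have [measurable]: "(\<lambda>\<omega>. \<Sum>r\<in>{V (n - 1) \<omega><..V n \<omega>}. snd (z \<omega> r)) \<in> borel_measurable M"
  proof (rule measurable_compose_countable[OF _ V])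
    show "(\<lambda>\<omega>. \<Sum>r\<in>{V (n - 1) \<omega><..s}. snd (z \<omega> r)) \<in> borel_measurable M" for s
      by (rule measurable_compose_countable[OF _ V]) measurable
  qed
  show ?thesis
    unfolding exclude_def Let_def V_def[symmetric] by (cases "n = 0") (simp_all, measurable)
qed

text \<open>Used for \<open>reduced_prob\<close>: \<open>emeasure\<close> is 0 on non-measurable
  sets, and \<open>P i\<close> is not assumed complete, so almost sure equality with a measurable
  map would not suffice.\<close>

lemma measurable_reduced:
  assumes "\<And>l. (\<lambda>\<omega>. z \<omega> l) \<in> M \<rightarrow>\<^sub>M count_space UNIV \<Otimes>\<^sub>M borel"
  shows "(\<lambda>\<omega>. reduced m k n (z \<omega>) l) \<in> M \<rightarrow>\<^sub>M count_space UNIV \<Otimes>\<^sub>M borel"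
proof (induction n arbitrary: l)
  case 0
  show ?case using assms by simp
next
  case (Suc n)
  show ?case unfolding Defs.reduced.simps(2) by (rule measurable_exclude, rule Suc)
qed

section \<open>Uniqueness of the output of the algorithm\<close>

lemma exclusion_order_phase_space:
  assumes "exclusion_order m i k"
  shows "n \<le> m \<Longrightarrow> 0 \<in> phase_space m k n"
    and "phase_space m k m = {0}"
    and "Suc n \<le> m \<Longrightarrow> k (Suc n) \<in> phase_space m k n"
    and "Suc n \<le> m \<Longrightarrow> k (Suc n) \<noteq> 0"
proof -
  have image: "k ` {1..m} = {1..m}" and inj: "inj_on k {1..m}"
    using assms by (auto simp: exclusion_order_def bij_betw_def)
  show "phase_space m k m = {0}" unfolding phase_space_def image by auto
  have sub: "k ` {1..n} \<subseteq> {1..m}" if "n \<le> m" for n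
    using that image_mono[of "{1..n}" "{1..m}" k] image by simp
  show "0 \<in> phase_space m k n" if "n \<le> m" using sub[OF that] by (auto simp: phase_space_def)
  assume n: "Suc n \<le> m"
  then have "k (Suc n) \<in> {1..m}" by (intro subsetD[OF sub[OF n]] imageI) simp
  moreover have "k (Suc n) \<notin> k ` {1..n}"
    using n by (subst inj_on_image_mem_iff[OF inj]) auto
  ultimately show "k (Suc n) \<in> phase_space m k n" "k (Suc n) \<noteq> 0" by (auto simp: phase_space_def)
qed

lemma phase_space_le: "j \<in> phase_space m k n \<Longrightarrow> j \<le> m"
  by (simp add: phase_space_def)

lemma recurrent_algorithm_step:
  assumes alg: "recurrent_algorithm m d k p0 e0 p e" and n: "Suc n \<le> m" and b: "b \<in> phase_space m k (Suc n)"
  defines "c \<equiv> k (Suc n)"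
  shows "p (Suc n) c b = p n c b / (1 - p n c c)"
    and "a \<in> phase_space m k (Suc n) \<Longrightarrow>
      p (Suc n) a b = p n a b + p n a c * (p n c b / (1 - p n c c))"
    and "r \<in> {1..d} \<Longrightarrow> e (Suc n) r c b = 1 / (1 - p n c c) *
      (e n r c b + (\<Sum>l=0..r-1. of_nat (r choose l) * e n (r - l) c c * e (Suc n) l c b))"
    and "r \<in> {1..d} \<Longrightarrow> a \<in> phase_space m k (Suc n) \<Longrightarrow> e (Suc n) r a b = e n r a b
      + (\<Sum>l=0..r-1. of_nat (r choose l) * e n (r - l) a c * e (Suc n) l c b)
      + p n a c / (1 - p n c c) *
        (e n r c b + (\<Sum>l=0..r-1. of_nat (r choose l) * e n (r - l) c c * e (Suc n) l c b))"
proof -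
  have "Suc n \<in> {1..m}" using n by simp
  note step = alg[unfolded recurrent_algorithm_def, THEN conjunct2, THEN conjunct2,
      THEN bspec, OF this, THEN bspec, OF b, unfolded diff_Suc_1, folded c_def]
  note e_step = step[THEN conjunct2, THEN conjunct2, THEN bspec]
  show "p (Suc n) c b = p n c b / (1 - p n c c)" by (rule step[THEN conjunct1])
  show "p (Suc n) a b = p n a b + p n a c * (p n c b / (1 - p n c c))" if "a \<in> phase_space m k (Suc n)"
    by (rule step[THEN conjunct2, THEN conjunct1, THEN bspec, OF that])
  show "e (Suc n) r c b = 1 / (1 - p n c c) *
      (e n r c b + (\<Sum>l=0..r-1. of_nat (r choose l) * e n (r - l) c c * e (Suc n) l c b))" if "r \<in> {1..d}"
    by (rule e_step[OF that, THEN conjunct1])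
  show "e (Suc n) r a b = e n r a b
      + (\<Sum>l=0..r-1. of_nat (r choose l) * e n (r - l) a c * e (Suc n) l c b)
      + p n a c / (1 - p n c c) *
        (e n r c b + (\<Sum>l=0..r-1. of_nat (r choose l) * e n (r - l) c c * e (Suc n) l c b))"
    if "r \<in> {1..d}" "a \<in> phase_space m k (Suc n)"
    by (rule e_step[OF that(1), THEN conjunct2, THEN bspec, OF that(2)])
qed

text \<open>Induction on the level, with an inner strong induction on the order for the start state
  just excluded, whose formula uses lower orders at the same level. The formulas for surviving start
  states use only these values and the previous level.\<close>

lemma recurrent_algorithm_unique:
  assumes alg: "recurrent_algorithm m d k p0 e0 p e" "recurrent_algorithm m d k p0 e0 p' e'"
    and order: "exclusion_order m i k"
    and "n \<le> m" "a \<in> phase_space m k (n - 1)" "b \<in> phase_space m k n" "r \<le> d"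
  shows "e n r a b = e' n r a b"
proof -
  note initial = alg[unfolded recurrent_algorithm_def, THEN conjunct1]
  have base: "p 0 a b = p' 0 a b \<and> (\<forall>r\<in>{1..d}. e 0 r a b = e' 0 r a b)" if "a \<le> m" "b \<le> m" for a b
    using initial that by simp
  note zero_index = alg[unfolded recurrent_algorithm_def, THEN conjunct2, THEN conjunct1]
  have zero: "e n 0 a b = p n a b" "e' n 0 a b = p' n a b"
    if "n \<le> m" "a \<in> phase_space m k (n - 1)" "b \<in> phase_space m k n" for n a b
    using zero_index that by simp_all
  have "p n a b = p' n a b \<and> (\<forall>r\<in>{1..d}. e n r a b = e' n r a b)"
    using \<open>n \<le> m\<close> \<open>a \<in> phase_space m k (n - 1)\<close> \<open>b \<in> phase_space m k n\<close>
  proof (induction n arbitrary: a b)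
    case 0
    then show ?case using base by (simp add: phase_space_def)
  next
    case (Suc n)
    let ?k = "k (Suc n)"
    have k: "?k \<in> phase_space m k n" using exclusion_order_phase_space(3)[OF order] Suc.prems(1) .
    have sub: "phase_space m k (Suc n) \<subseteq> phase_space m k n" "phase_space m k n \<subseteq> phase_space m k (n - 1)"
      by (auto simp: phase_space_def)
    note b = Suc.prems(3)
    note b' = subsetD[OF sub(1) b]
    have p_eq: "p n a b = p' n a b" and e_eq: "r \<in> {1..d} \<Longrightarrow> e n r a b = e' n r a b"
      if "a \<in> phase_space m k n" "b \<in> phase_space m k n" for a b r
      using Suc.IH[OF Suc_leD[OF Suc.prems(1)] subsetD[OF sub(2) that(1)] that(2)] by simp_all
    note step = recurrent_algorithm_step[OF alg(1) Suc.prems(1) b]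
    note step' = recurrent_algorithm_step[OF alg(2) Suc.prems(1) b]
    have p_self: "p (Suc n) ?k b = p' (Suc n) ?k b"
      unfolding step(1) step'(1) p_eq[OF k k] p_eq[OF k b'] ..
    have sums: "(\<Sum>l=0..r-1. of_nat (r choose l) * e n (r - l) c ?k * e (Suc n) l ?k b)
        = (\<Sum>l=0..r-1. of_nat (r choose l) * e' n (r - l) c ?k * e' (Suc n) l ?k b)"
      if "r \<in> {1..d}" "c \<in> phase_space m k n" "\<forall>l<r. e (Suc n) l ?k b = e' (Suc n) l ?k b" for r c
      using that(1) by (intro sum.cong refl arg_cong2[where f = "(*)"] e_eq[OF that(2) k] that(3)[rule_format]) auto
    have e_self: "e (Suc n) r ?k b = e' (Suc n) r ?k b" if "r \<le> d" for r
      using that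
    proof (induction r rule: less_induct)
      case (less r)
      show ?case
      proof (cases "r = 0")
        case True
        then show ?thesis using zero[of "Suc n" ?k b] p_self k b Suc.prems(1) by simp
      next
        case False
        then have r: "r \<in> {1..d}" using less by auto
        have "\<forall>l<r. e (Suc n) l ?k b = e' (Suc n) l ?k b" using less by simp
        from sums[OF r k this] show ?thesis
          unfolding step(3)[OF r] step'(3)[OF r] e_eq[OF k b' r] p_eq[OF k k] by (rule arg_cong)
      qed
    qed
    show ?case
    proof (cases "a = ?k")
      case True
      then show ?thesis using p_self e_self by simp
    next
      case False
      then have a: "a \<in> phase_space m k (Suc n)" using Suc.prems(2) by (simp add: phase_space_Suc)
      note a' = subsetD[OF sub(1) a]
      have "e (Suc n) r a b = e' (Suc n) r a b" if r: "r \<in> {1..d}" for r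
      proof -
        have "\<forall>l<r. e (Suc n) l ?k b = e' (Suc n) l ?k b" using e_self r by simp
        note sums = sums[OF r a' this] sums[OF r k this]
        show ?thesis
          unfolding step(4)[OF r a] step'(4)[OF r a] sums e_eq[OF k b' r] e_eq[OF a' b' r]
            p_eq[OF k k] p_eq[OF a' k] ..
      qed
      moreover have "p (Suc n) a b = p' (Suc n) a b"
        unfolding step(2)[OF a] step'(2)[OF a] p_eq[OF a' b'] p_eq[OF a' k] p_eq[OF k b'] p_eq[OF k k] ..
      ultimately show ?thesis by simp
    qed
  qed
  then show ?thesis using zero[of n a b] assms(4-7) by (cases "r = 0") auto
qed

section \<open>Identification of the probabilistic quantities with passage moments\<close>

context markov_renewal_process
begin

lemma full_moment_all:
  assumes i: "i \<le> m"
  shows "full_moment {0..m} r i j = transition_moment P J X r i j"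
  unfolding passage_moment_def transition_moment_def
proof (rule nn_integral_cong)
  fix \<omega> assume "\<omega> \<in> space (P i)"
  then have \<omega>: "\<omega> \<in> space \<Omega>" by (simp add: space_P i)
  have "hit {0..m} (future 0 \<omega>) = 0"
    by (rule hit_eqI) (simp_all add: future_def J_le[OF \<omega>])
  then show "reward {0..m} \<infinity> r j (future 0 \<omega>) = ennreal (X 1 \<omega> ^ r) * indicator {\<omega>. J 1 \<omega> = j} \<omega>"
    using X_nonneg[OF \<omega>]
    by (simp add: reward_def elapsed_def place_def future_def ennreal_power indicator_def)
qed

text \<open>From \<open>x ^ r \<le> 1 + x ^ d\<close> for x \<ge> 0 and total mass 1.\<close>

lemma transition_moment_finite:
  assumes i: "i \<le> m" and r: "r \<le> d" and fin: "transition_moment P J X d i j < \<infinity>"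
  shows "transition_moment P J X r i j < \<infinity>"
proof -
  interpret prob_space "P i" using i by (rule prob_space_P)
  note sets_P[OF i, measurable_cong]
  have pow: "x ^ r \<le> 1 + x ^ d" if "0 \<le> x" for x :: real
  proof (cases "x \<le> 1")
    case True
    then show ?thesis using that power_le_one[of x r] zero_le_power[of x d] by linarith
  next
    case False
    then show ?thesis using power_increasing[OF r, of x] by linarith
  qed
  have pow': "ennreal (x ^ r) \<le> 1 + ennreal (x ^ d)" if "0 \<le> x" for x
  proof -
    have "ennreal (x ^ r) \<le> ennreal (1 + x ^ d)" by (rule ennreal_leI[OF pow[OF that]])
    also have "\<dots> = 1 + ennreal (x ^ d)" using that by (subst ennreal_plus) auto
    finally show ?thesis .
  qed
  have "transition_moment P J X r i j
      \<le> (\<integral>\<^sup>+\<omega>. 1 + ennreal (X 1 \<omega> ^ d) * indicator {\<omega> \<in> space \<Omega>. J 1 \<omega> = j} \<omega> \<partial>P i)"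
    unfolding transition_moment_def
    using pow'[OF X_nonneg] by (intro nn_integral_mono) (auto simp: space_P i indicator_def)
  also have "\<dots> = 1 + (\<integral>\<^sup>+\<omega>. ennreal (X 1 \<omega> ^ d) * indicator {\<omega> \<in> space \<Omega>. J 1 \<omega> = j} \<omega> \<partial>P i)"
    by (subst nn_integral_add) (auto simp: emeasure_space_1)
  also have "(\<integral>\<^sup>+\<omega>. ennreal (X 1 \<omega> ^ d) * indicator {\<omega> \<in> space \<Omega>. J 1 \<omega> = j} \<omega> \<partial>P i)
      = transition_moment P J X d i j"
    unfolding transition_moment_def
    by (intro nn_integral_cong) (auto simp: space_P i indicator_def)
  also have "1 + transition_moment P J X d i j < \<infinity>" using fin by simp
  finally show ?thesis .
qed

text \<open>On t \<ge> 0, \<open>Q i j\<close> is the distribution function of \<open>X 1\<close>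
  restricted to \<open>J 1 = j\<close>; its limit at infinity is the total mass of that
  measure.\<close>

lemma embedded_prob_eq:
  assumes i: "i \<le> m" and j: "j \<le> m"
  shows "ennreal (embedded_prob Q i j) = full_moment {0..m} 0 i j"
proof -
  interpret prob_space "P i" using i by (rule prob_space_P)
  note sets_P[OF i, measurable_cong]
  let ?A = "{\<omega> \<in> space \<Omega>. J 1 \<omega> = j}"
  define M where "M = distr (density (P i) (indicator ?A)) borel (X 1)"
  have emeasure_M: "emeasure M C = emeasure (P i) (?A \<inter> (X 1 -` C \<inter> space \<Omega>))" if "C \<in> sets borel" for C
    using that unfolding M_def by (simp add: emeasure_distr emeasure_restricted space_P i)
  have sets_M: "sets M = sets borel" by (simp add: M_def)
  have space_M: "space M = UNIV" using sets_eq_imp_space_eq[OF sets_M] by simp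
  interpret M: finite_borel_measure M
    unfolding finite_borel_measure_def finite_borel_measure_axioms_def
    by (auto intro!: finite_measureI simp: sets_M space_M emeasure_M emeasure_eq_measure)
  have "cdf M t = Q i j t" if t: "0 \<le> t" for t
  proof -
    have "?A \<inter> (X 1 -` {..t} \<inter> space \<Omega>) = {\<omega> \<in> space \<Omega>. J 1 \<omega> = j \<and> X 1 \<omega> \<le> t}" by auto
    then show ?thesis
      using emeasure_M[of "{..t}"] unfolding Q_eq[OF i j t] cdf_def measure_def by simp
  qed
  then have ev: "eventually (\<lambda>t. cdf M t = Q i j t) at_top"
    by (intro eventually_at_top_linorderI[of 0])
  have "measure M (space M) = measure (P i) ?A"
  proof -
    have "?A \<inter> (X 1 -` UNIV \<inter> space \<Omega>) = ?A" by auto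
    then show ?thesis using emeasure_M[of UNIV] unfolding measure_def space_M by simp
  qed
  then have "(Q i j \<longlongrightarrow> measure (P i) ?A) at_top"
    using Lim_transform_eventually[OF M.cdf_lim_at_top ev] by simp
  then have "embedded_prob Q i j = measure (P i) ?A"
    unfolding embedded_prob_def by (intro tendsto_Lim) auto
  then have "ennreal (embedded_prob Q i j) = emeasure (P i) ?A" by (simp add: emeasure_eq_measure)
  also have "\<dots> = transition_moment P J X 0 i j"
    unfolding transition_moment_def
    by (subst nn_integral_indicator[symmetric], measurable, intro nn_integral_cong)
      (auto simp: indicator_def space_P i)
  finally show ?thesis by (simp add: full_moment_all i)
qed

lemma AE_reduced:
  assumes comm: "communicating m P J" and i: "i \<le> m" and zero: "0 \<in> phase_space m k n"
  shows "AE \<omega> in P i. \<omega> \<in> space \<Omega> \<and> reduced_J m k J X n 1 \<omega> = place (phase_space m k n) (future 0 \<omega>)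
    \<and> reduced_X m k J X n 1 \<omega> = elapsed (phase_space m k n) (future 0 \<omega>)"
  using AE_infinitely_often_zero[OF comm i] AE_space
proof eventually_elim
  case (elim \<omega>)
  then have \<omega>: "\<omega> \<in> space \<Omega>" by (simp add: space_P i)
  have "\<forall>r. \<exists>l>r. J l \<omega> \<in> phase_space m k n" using elim(1) zero by metis
  then have "reduced m k n (\<lambda>l. (J l \<omega>, X l \<omega>)) 1
      = (place (phase_space m k n) (future 0 \<omega>), elapsed (phase_space m k n) (future 0 \<omega>))"
    using reduced_one[of "\<lambda>l. (J l \<omega>, X l \<omega>)" m k n] J_le[OF \<omega>]
    by (simp add: future_def[abs_def])
  then show ?case using \<omega> by (simp add: reduced_J_def reduced_X_def)
qed

lemma reduced_moment_eq:
  assumes "communicating m P J" and i: "i \<le> m" and "0 \<in> phase_space m k n"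
  shows "reduced_moment m k P J X n r i j = full_moment (phase_space m k n) r i j"
  unfolding reduced_moment_def transition_moment_def passage_moment_def
proof (rule nn_integral_cong_AE, use AE_reduced[OF assms] in eventually_elim)
  case (elim \<omega>)
  then show ?case
    using elapsed_nonneg[of \<omega> "phase_space m k n" 0]
    by (auto simp: reward_def ennreal_power indicator_def)
qed

lemma reduced_prob_eq:
  assumes "communicating m P J" and i: "i \<le> m" and "0 \<in> phase_space m k n"
  shows "reduced_prob m k P J X n i j = full_moment (phase_space m k n) 0 i j"
proof -
  note sets_P[OF i, measurable_cong]
  have "(\<lambda>\<omega>. reduced m k n (\<lambda>l. (J l \<omega>, X l \<omega>)) 1) \<in> \<Omega> \<rightarrow>\<^sub>M count_space UNIV \<Otimes>\<^sub>M borel"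
    by (rule measurable_reduced) measurable
  then have "reduced_J m k J X n 1 \<in> \<Omega> \<rightarrow>\<^sub>M count_space UNIV"
    unfolding reduced_J_def by (rule measurable_compose[OF _ measurable_fst])
  then have "reduced_J m k J X n 1 -` {j} \<inter> space (P i) \<in> sets (P i)"
    unfolding sets_P[OF i] space_P[OF i] by (rule measurable_sets) simp
  then have "{\<omega> \<in> space (P i). reduced_J m k J X n 1 \<omega> = j} \<in> sets (P i)"
    by (simp add: vimage_def Int_def conj_commute)
  then have "reduced_prob m k P J X n i j
      = (\<integral>\<^sup>+\<omega>. indicator {\<omega> \<in> space (P i). reduced_J m k J X n 1 \<omega> = j} \<omega> \<partial>P i)"
    by (simp add: reduced_prob_def)
  also have "\<dots> = reduced_moment m k P J X n 0 i j"
    unfolding reduced_moment_def transition_moment_def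
    by (intro nn_integral_cong) (simp add: indicator_def)
  finally show ?thesis by (simp add: reduced_moment_eq assms)
qed

text \<open>Condition B supplies positive durations and recurrence supplies a visit to 0, so
  \<open>hitting_time_eq\<close> applies to almost every trajectory.\<close>

lemma hitting_moment_eq:
  assumes comm: "communicating m P J" and B: "\<forall>q\<in>{0..m}. \<forall>j\<in>{0..m}. Q q j 0 = 0"
    and i: "i \<le> m"
  shows "hitting_moment P J X r i = full_moment {0} r i 0"
  unfolding hitting_moment_def passage_moment_def
proof (rule nn_integral_cong_AE,
    use AE_infinitely_often_zero[OF comm i] AE_X_pos[OF B i] in eventually_elim)
  case (elim \<omega>)
  have hits: "\<exists>n. J (Suc n) \<omega> = 0" using elim(1) by (metis gr0_implies_Suc not_less_zero)
  have "future 0 \<omega> = (\<lambda>n. (J (Suc n) \<omega>, X (Suc n) \<omega>))" by (simp add: future_def fun_eq_iff)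
  moreover have "place {0} (\<lambda>n. (J (Suc n) \<omega>, X (Suc n) \<omega>)) = 0"
    using place_in[of "\<lambda>n. (J (Suc n) \<omega>, X (Suc n) \<omega>)" "{0}"] hits by auto
  ultimately show ?case
    using hitting_time_eq[of "\<lambda>n. X n \<omega>" "\<lambda>n. J n \<omega>"] elim(2) hits
    by (simp add: reward_def)
qed

lemma full_moment_0_zero:
  assumes comm: "communicating m P J" and i: "i \<le> m"
  shows "full_moment {0} 0 i 0 = 1"
proof -
  interpret prob_space "P i" using i by (rule prob_space_P)
  have "full_moment {0} 0 i 0 = (\<integral>\<^sup>+\<omega>. 1 \<partial>P i)"
    unfolding passage_moment_def
  proof (rule nn_integral_cong_AE, use AE_infinitely_often_zero[OF comm i] in eventually_elim)
    case (elim \<omega>)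
    then have "\<exists>s. fst (future 0 \<omega> s) \<in> {0}" by (metis future_hits comm insertI1)
    then show ?case using place_in[of "future 0 \<omega>" "{0}"] by (auto simp: reward_def)
  qed
  then show ?thesis by (simp add: emeasure_space_1)
qed

text \<open>All orders up to d are carried through the induction together, since order r at one
  level draws on all lower orders at the level before.\<close>

lemma full_moment_phase_space_finite:
  assumes comm: "communicating m P J" and order: "exclusion_order m a k"
    and C: "\<forall>i\<in>{0..m}. \<forall>j\<in>{0..m}. transition_moment P J X d i j < \<infinity>"
    and "n \<le> m" "r \<le> d" "i \<le> m" "j \<in> phase_space m k n"
  shows "full_moment (phase_space m k n) r i j < \<infinity>"
  using assms(4-)
proof (induction n arbitrary: r i j)
  case 0
  then show ?case
    using full_moment_all transition_moment_finite[of i r d j] C by (simp add: phase_space_def)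
next
  case (Suc n)
  note ps = exclusion_order_phase_space[OF order]
  note n = Suc.prems(1)
  show ?case
    unfolding phase_space_Suc
  proof (rule full_moment_remove_finite[OF comm ps(1)[OF Suc_leD[OF n]] ps(3)[OF n]
        phase_space_le[OF ps(3)[OF n]] ps(4)[OF n]])
    show "full_moment (phase_space m k n) l i j < \<infinity>"
      if "l \<le> r" "i \<le> m" "j \<in> phase_space m k n" for l i j
      using Suc.IH that Suc.prems by simp
    show "i \<le> m" "j \<in> phase_space m k n - {k (Suc n)}"
      using Suc.prems by (simp_all add: phase_space_Suc)
  qed
qed

end

theorem theorem2:
  fixes m d i :: nat
    and Q :: "nat \<Rightarrow> nat \<Rightarrow> real \<Rightarrow> real"
    and \<Omega> :: "'a measure"
    and P :: "nat \<Rightarrow> 'a measure"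
    and J :: "nat \<Rightarrow> 'a \<Rightarrow> nat"
    and X :: "nat \<Rightarrow> 'a \<Rightarrow> real"
  assumes process: "markov_renewal_process m Q \<Omega> P J X"
    and d: "1 \<le> d"
    and A: "communicating m P J"
    and B: "\<forall>i\<in>{0..m}. \<forall>j\<in>{0..m}. Q i j 0 = 0"
    and C: "\<forall>i\<in>{0..m}. \<forall>j\<in>{0..m}. transition_moment P J X d i j < \<infinity>"
    and i: "i \<in> {1..m}"
  shows
    "(\<forall>k. exclusion_order m i k \<longrightarrow>
        recurrent_algorithm m d k
          (\<lambda>i' j'. ennreal (embedded_prob Q i' j')) (transition_moment P J X)
          (reduced_prob m k P J X) (reduced_moment m k P J X) \<and>
        (\<forall>n\<in>{1..m}. reduced_prob m k P J X (n - 1) (k n) (k n) < 1) \<and>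
        (\<forall>n\<in>{0..m}. \<forall>i'\<in>phase_space m k (n - 1). \<forall>j'\<in>phase_space m k n. \<forall>r\<in>{1..d}.
           reduced_moment m k P J X n r i' j' < \<infinity>) \<and>
        reduced_prob m k P J X m i 0 = 1 \<and> reduced_prob m k P J X m 0 0 = 1 \<and>
        (\<forall>r\<in>{1..d}.
           hitting_moment P J X r i = reduced_moment m k P J X m r i 0 \<and>
           hitting_moment P J X r 0 = reduced_moment m k P J X m r 0 0)) \<and>
     (\<forall>k k' p e p' e'.
        exclusion_order m i k \<and> exclusion_order m i k' \<and>
        recurrent_algorithm m d k
          (\<lambda>i' j'. ennreal (embedded_prob Q i' j')) (transition_moment P J X) p e \<and>
        recurrent_algorithm m d k'
          (\<lambda>i' j'. ennreal (embedded_prob Q i' j')) (transition_moment P J X) p' e' \<longrightarrow>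
        (\<forall>r\<in>{1..d}. e m r i 0 = e' m r i 0 \<and> e m r 0 0 = e' m r 0 0))"
proof -
  interpret markov_renewal_process m Q \<Omega> P J X by (rule process)
  let ?p0 = "\<lambda>i' j'. ennreal (embedded_prob Q i' j')"
  have im: "i \<le> m" using i by simp
  have main: "recurrent_algorithm m d k ?p0 (transition_moment P J X)
        (reduced_prob m k P J X) (reduced_moment m k P J X) \<and>
      (\<forall>n\<in>{1..m}. reduced_prob m k P J X (n - 1) (k n) (k n) < 1) \<and>
      (\<forall>n\<in>{0..m}. \<forall>i'\<in>phase_space m k (n - 1). \<forall>j'\<in>phase_space m k n. \<forall>r\<in>{1..d}.
         reduced_moment m k P J X n r i' j' < \<infinity>) \<and>
      reduced_prob m k P J X m i 0 = 1 \<and> reduced_prob m k P J X m 0 0 = 1 \<and>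
      (\<forall>r\<in>{1..d}.
         hitting_moment P J X r i = reduced_moment m k P J X m r i 0 \<and>
         hitting_moment P J X r 0 = reduced_moment m k P J X m r 0 0)"
    if order: "exclusion_order m i k" for k
  proof -
    let ?S = "phase_space m k"
    note ps = exclusion_order_phase_space[OF order]
    have e: "reduced_moment m k P J X n r a b = full_moment (?S n) r a b" if "n \<le> m" "a \<le> m" for n r a b
      using reduced_moment_eq[OF A that(2) ps(1)] that(1) by simp
    have p: "reduced_prob m k P J X n a b = full_moment (?S n) 0 a b" if "n \<le> m" "a \<le> m" for n a b
      using reduced_prob_eq[OF A that(2) ps(1)] that(1) by simp
    have fin: "full_moment (?S n) r a b < \<infinity>" if "n \<le> m" "r \<le> d" "a \<le> m" "b \<in> ?S n" for n r a b
      using full_moment_phase_space_finite[OF A order C that] .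
    have S0: "?S 0 = {0..m}" by (simp add: phase_space_def)
    \<comment> \<open>The range l < r is deliberate: at r = 0 the sum is empty and the identity
      becomes the formula for the transition probabilities, whereas \<open>{0..0 - 1}\<close> would
      be \<open>{0}\<close>. For r \<ge> 1 the two ranges agree.\<close>
    have self: "full_moment (?S (Suc n)) r (k (Suc n)) b
        = 1 / (1 - full_moment (?S n) 0 (k (Suc n)) (k (Suc n))) * (full_moment (?S n) r (k (Suc n)) b
          + (\<Sum>l<r. of_nat (r choose l) * full_moment (?S n) (r - l) (k (Suc n)) (k (Suc n))
              * full_moment (?S (Suc n)) l (k (Suc n)) b))"
      if n: "Suc n \<le> m" and b: "b \<in> ?S (Suc n)" and r: "r \<le> d" for n b r
      using full_moment_remove_self[OF A ps(1)[OF Suc_leD[OF n]] ps(3)[OF n] phase_space_le[OF ps(3)[OF n]] ps(4)[OF n], of r b]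
        fin[OF n r phase_space_le[OF ps(3)[OF n]] b] n b
      by (simp add: phase_space_Suc)
    have other: "full_moment (?S (Suc n)) r a b = full_moment (?S n) r a b
        + (\<Sum>l<r. of_nat (r choose l) * full_moment (?S n) (r - l) a (k (Suc n))
            * full_moment (?S (Suc n)) l (k (Suc n)) b)
        + full_moment (?S n) 0 a (k (Suc n)) / (1 - full_moment (?S n) 0 (k (Suc n)) (k (Suc n)))
          * (full_moment (?S n) r (k (Suc n)) b
            + (\<Sum>l<r. of_nat (r choose l) * full_moment (?S n) (r - l) (k (Suc n)) (k (Suc n))
                * full_moment (?S (Suc n)) l (k (Suc n)) b))"
      if n: "Suc n \<le> m" and a: "a \<le> m" and b: "b \<in> ?S (Suc n)" and r: "r \<le> d" for n a b r
    proof -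
      have "full_moment (?S (Suc n)) r a b = full_moment (?S n) r a b
        + (\<Sum>l<r. of_nat (r choose l) * full_moment (?S n) (r - l) a (k (Suc n))
            * full_moment (?S (Suc n)) l (k (Suc n)) b)
        + full_moment (?S n) 0 a (k (Suc n)) * full_moment (?S (Suc n)) r (k (Suc n)) b"
        using full_moment_remove[OF A ps(1)[OF Suc_leD[OF n]] ps(3)[OF n] phase_space_le[OF ps(3)[OF n]] ps(4)[OF n] a, of b r]
          n b
        unfolding lessThan_Suc_atMost[symmetric] sum.lessThan_Suc
        by (simp add: phase_space_Suc add.assoc)
      also note self[OF n b r]
      finally show ?thesis by (simp add: divide_ennreal_def mult.assoc)
    qed
    have less_1: "full_moment (?S n) 0 (k (Suc n)) (k (Suc n)) < 1" if n: "Suc n \<le> m" for n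
      using return_prob_less_1[OF A ps(1)[OF Suc_leD[OF n]] ps(3)[OF n]
          phase_space_le[OF ps(3)[OF n]] ps(4)[OF n]] .
    have atMost: "{0..r - 1} = {..<r}" if "r \<in> {1..d}" for r using that by auto
    have "recurrent_algorithm m d k ?p0 (transition_moment P J X)
        (reduced_prob m k P J X) (reduced_moment m k P J X)"
      unfolding recurrent_algorithm_def
    proof (intro conjI ballI)
      fix a b assume "a \<in> {0..m}" "b \<in> {0..m}"
      then show "reduced_prob m k P J X 0 a b = ?p0 a b"
        and "\<And>r. reduced_moment m k P J X 0 r a b = transition_moment P J X r a b"
        by (simp_all add: p e S0 embedded_prob_eq full_moment_all)
    next
      fix n a b assume "n \<in> {0..m}" "a \<in> ?S (n - 1)" "b \<in> ?S n"
      then show "reduced_moment m k P J X n 0 a b = reduced_prob m k P J X n a b"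
        by (simp add: p e phase_space_le)
    next
      fix n b assume n: "n \<in> {1..m}" and b: "b \<in> ?S n"
      then obtain n' where n': "n = Suc n'" "Suc n' \<le> m" by (cases n) auto
      have k: "k n \<le> m" using phase_space_le[OF ps(3)[OF n'(2)]] n'(1) by simp
      note simps = n'(1) p e phase_space_le n'(2) k[unfolded n'(1)] Suc_leD[OF n'(2)] diff_Suc_1
      show "reduced_prob m k P J X n (k n) b
          = reduced_prob m k P J X (n - 1) (k n) b / (1 - reduced_prob m k P J X (n - 1) (k n) (k n))"
        using self[OF n'(2) b[unfolded n'(1)], of 0]
        by (simp add: simps divide_ennreal_def mult.commute)
      fix a assume a: "a \<in> ?S n"
      show "reduced_prob m k P J X n a b = reduced_prob m k P J X (n - 1) a b
          + reduced_prob m k P J X (n - 1) a (k n)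
            * (reduced_prob m k P J X (n - 1) (k n) b / (1 - reduced_prob m k P J X (n - 1) (k n) (k n)))"
        using other[OF n'(2) phase_space_le[OF a] b[unfolded n'(1)], of 0] phase_space_le[OF a]
        by (simp add: simps divide_ennreal_def mult_ac)
    next
      fix n b r assume n: "n \<in> {1..m}" and b: "b \<in> ?S n" and r: "r \<in> {1..d}"
      then obtain n' where n': "n = Suc n'" "Suc n' \<le> m" by (cases n) auto
      have k: "k n \<le> m" using phase_space_le[OF ps(3)[OF n'(2)]] n'(1) by simp
      have rd: "r \<le> d" using r by simp
      note simps = n'(1) p e n'(2) k[unfolded n'(1)] Suc_leD[OF n'(2)] diff_Suc_1
      show "reduced_moment m k P J X n r (k n) b =
        1 / (1 - reduced_prob m k P J X (n - 1) (k n) (k n)) *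
          (reduced_moment m k P J X (n - 1) r (k n) b
            + (\<Sum>l = 0..r - 1. of_nat (r choose l) * reduced_moment m k P J X (n - 1) (r - l) (k n) (k n)
                * reduced_moment m k P J X n l (k n) b))"
        unfolding atMost[OF r] using self[OF n'(2) b[unfolded n'(1)] rd]
        by (simp only: simps)
      fix a assume a: "a \<in> ?S n"
      show "reduced_moment m k P J X n r a b = reduced_moment m k P J X (n - 1) r a b
          + (\<Sum>l = 0..r - 1. of_nat (r choose l) * reduced_moment m k P J X (n - 1) (r - l) a (k n)
              * reduced_moment m k P J X n l (k n) b)
          + reduced_prob m k P J X (n - 1) a (k n) / (1 - reduced_prob m k P J X (n - 1) (k n) (k n)) *
            (reduced_moment m k P J X (n - 1) r (k n) b
              + (\<Sum>l = 0..r - 1. of_nat (r choose l) * reduced_moment m k P J X (n - 1) (r - l) (k n) (k n)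
                  * reduced_moment m k P J X n l (k n) b))"
        unfolding atMost[OF r] using other[OF n'(2) phase_space_le[OF a] b[unfolded n'(1)] rd]
        by (simp only: simps phase_space_le[OF a])
    qed
    moreover have "reduced_prob m k P J X (n - 1) (k n) (k n) < 1" if "n \<in> {1..m}" for n
      using that less_1[of "n - 1"] phase_space_le[OF ps(3)[of "n - 1"]] p[of "n - 1" "k n" "k n"]
      by auto
    moreover have "reduced_moment m k P J X n r a b < \<infinity>"
      if "n \<in> {0..m}" "a \<in> ?S (n - 1)" "b \<in> ?S n" "r \<in> {1..d}" for n a b r
      using that fin[of n r a b] by (simp add: e phase_space_le)
    ultimately show ?thesis
      using full_moment_0_zero[OF A] hitting_moment_eq[OF A B] im
      by (simp add: p e ps(2))
  qed
  have determined: "e m r a 0 = hitting_moment P J X r a"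
    if order: "exclusion_order m i k" and alg: "recurrent_algorithm m d k ?p0 (transition_moment P J X) p e"
      and r: "r \<in> {1..d}" and a: "a = i \<or> a = 0" for k p e r a
  proof -
    note ps = exclusion_order_phase_space[OF order]
    have "k m = i" using order by (simp add: exclusion_order_def)
    then have "a \<in> phase_space m k (m - 1)" using ps(1,3)[of "m - 1"] i a by auto
    then have "e m r a 0 = reduced_moment m k P J X m r a 0"
      using recurrent_algorithm_unique[OF alg main[OF order, THEN conjunct1] order, of m a 0 r] ps(2) r
      by simp
    then show ?thesis using main[OF order] r a by auto
  qed
  have invariant: "\<forall>r\<in>{1..d}. e m r i 0 = e' m r i 0 \<and> e m r 0 0 = e' m r 0 0"
    if "exclusion_order m i k" "exclusion_order m i k'"
      "recurrent_algorithm m d k ?p0 (transition_moment P J X) p e"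
      "recurrent_algorithm m d k' ?p0 (transition_moment P J X) p' e'" for k k' p e p' e'
    using determined[OF that(1,3)] determined[OF that(2,4)] by simp
  show ?thesis using main invariant by blast
qed

end
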